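(* Let $H$ be a separable complex Hilbert space. A function $\Gamma:\mathbb{Z}\to\mathcal{L}(H)$ is non-negative definite if and only if $$\Gamma(h)=\int_{-\pi}^{\pi}e^{\mathrm{i}h\omega}\,d\mathscr{F}(\omega),\qquad h\in\mathbb{Z},$$ where $\mathscr{F}$ is a finite $\mathcal{L}^+_\infty$-valued measure on $[-\pi,\pi]$ with $\mathscr{F}(-\pi)=O_H$. The finite measure $\mathscr{F}$ is uniquely determined by $\Gamma(h)$, $h\in\mathbb{Z}$.
   Context: $\mathcal{L}(H)$ is the space of bounded linear operators on $H$, $\mathcal{L}(H)^+$ the cone of non-negative definite ones, $S_1(H)^+$ the cone of non-negative definite trace class operators on $H$, and $O_H$ the zero operator. A function $\Gamma:\mathbb{Z}\to\mathcal{L}(H)$ is called non-negative definite if $\sum_{i,j=1}^n\langle c(i,j)g_j,g_i\rangle\ge 0$ for all $n\in\mathbb{N}$ and $g_1,\dots,g_n\in H$, where $c(i,j)=\Gamma(i-j)$ is the associated kernel on $\mathbb{Z}\times\mathbb{Z}$; this is understood in the usual sense of kernels, i.e. $\sum_{i,j=1}^n\langle\Gamma(h_i-h_j)g_j,g_i\rangle\ge0$ for all $h_1,\dots,h_n\in\mathbb{Z}$, $g_1,\dots,g_n\in H$, $n\in\mathbb{N}$. $\mathcal{L}^+_\infty:=\mathrm{Hom}_{mon}(S_1(H)^+,[0,\infty])$ is the set of all maps $f:S_1(H)^+\to[0,\infty]$ with $f(A_1+A_2)=f(A_1)+f(A_2)$ and $f(O_H)=0$, with pointwise addition and the topology of pointwise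 convergence. An operator $B\in\mathcal{L}(H)^+$ is identified with the element $A\mapsto\mathrm{tr}(BA)$; under this identification $\mathcal{L}(H)^+$ is the subset $\mathrm{Hom}_{mon}(S_1(H)^+,[0,\infty))$. Let $\mathcal{B}$ be the Borel $\sigma$-algebra of $[-\pi,\pi]$. An $\mathcal{L}^+_\infty$-valued measure on $[-\pi,\pi]$ (also called an $\mathcal{L}(H)^+$-valued measure) is a map $\mathscr{F}:\mathcal{B}\to\mathcal{L}^+_\infty$ with $\mathscr{F}(\emptyset)=O_H$ that is countably additive, i.e. $\mathscr{F}(\bigcup_iE_i)(A)=\sum_i\mathscr{F}(E_i)(A)$ for all $A\in S_1(H)^+$ and pairwise disjoint $E_i\in\mathcal{B}$. It is finite if $\mathscr{F}([-\pi,\pi])\in\mathcal{L}(H)^+$; then $\mathscr{F}(E)\in\mathcal{L}(H)^+$ for all $E\in\mathcal{B}$. For $A\in S_1(H)^+$, $\mathscr{F}_A(E):=\mathscr{F}(E)(A)=\mathrm{tr}(\mathscr{F}(E)A)$ is a finite scalar measure. For a bounded Borel function $f:[-\pi,\pi]\to\mathbb{C}$, $\int f\,d\mathscr{F}$ denotes the operator in $\mathcal{L}(H)$ determined by $\mathrm{tr}\big((\int f\,d\mathscr{F})A\big)=\int f\,d\mathscr{F}_A$ for all $A\in S_1(H)^+$. One writes $\mathscr{F}(\omega):=\mathscr{F}([-\pi,\omega])$, so $\mathscr{F}(-\pi)=O_H$ means that $\mathscr{F}$ has no mass at $-\pi$. *)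

theory Defs
  imports "HOL-Analysis.Analysis"
begin

section \<open>Complex Hilbert spaces\<close>

text \<open>The inner product is linear in its first argument. The parent class supplies the real
  vector space structure, the norm and the metric; completeness is added in the second class.\<close>

class complex_inner_space = real_normed_vector +
  fixes scaleC :: "complex \<Rightarrow> 'a \<Rightarrow> 'a"  (infixr \<open>*\<^sub>C\<close> 75)
    and cinner :: "'a \<Rightarrow> 'a \<Rightarrow> complex"
  assumes scaleC_add_right: "c *\<^sub>C (x + y) = c *\<^sub>C x + c *\<^sub>C y"
    and scaleC_add_left: "(c + d) *\<^sub>C x = c *\<^sub>C x + d *\<^sub>C x"
    and scaleC_scaleC: "c *\<^sub>C d *\<^sub>C x = (c * d) *\<^sub>C x"
    and scaleR_scaleC: "r *\<^sub>R x = complex_of_real r *\<^sub>C x"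
    and cinner_add_left: "cinner (x + y) z = cinner x z + cinner y z"
    and cinner_scaleC_left: "cinner (c *\<^sub>C x) y = c * cinner x y"
    and cinner_commute: "cinner x y = cnj (cinner y x)"
    and cinner_self_norm: "cinner x x = complex_of_real ((norm x)\<^sup>2)"

class complex_hilbert_space = complex_inner_space + complete_space

instantiation complex :: complex_hilbert_space
begin

definition scaleC_complex :: "complex \<Rightarrow> complex \<Rightarrow> complex" where
  "scaleC_complex c x = c * x"

definition cinner_complex :: "complex \<Rightarrow> complex \<Rightarrow> complex" where
  "cinner_complex x y = x * cnj y"

instance
proof
qed (simp_all add: scaleC_complex_def cinner_complex_def algebra_simps scaleR_conv_of_real
      complex_norm_square[symmetric])

end

text \<open>Orthonormal bases are the maximal orthonormal sets.\<close>

definition is_onb :: "'a::complex_inner_space set \<Rightarrow> bool" where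
  "is_onb B \<longleftrightarrow>
     (\<forall>x\<in>B. \<forall>y\<in>B. cinner x y = (if x = y then 1 else 0)) \<and>
     (\<forall>x. (\<forall>e\<in>B. cinner x e = 0) \<longrightarrow> x = 0)"

definition some_onb :: "'a::complex_inner_space set" where
  "some_onb = (SOME B. is_onb B)"


section \<open>Operators, trace and trace class\<close>

text \<open>The library type of bounded linear maps is the type of bounded \<^emph>\<open>real\<close>-linear maps, so
  $\mathcal{L}(H)$ is carved out as a subset of it.\<close>

definition bounded_ops :: "('a::complex_hilbert_space \<Rightarrow>\<^sub>L 'a) set" where
  "bounded_ops = {T. \<forall>c x. blinfun_apply T (c *\<^sub>C x) = c *\<^sub>C blinfun_apply T x}"

definition pos_ops :: "('a::complex_hilbert_space \<Rightarrow>\<^sub>L 'a) set" where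
  "pos_ops = {T \<in> bounded_ops. \<forall>x. cinner (blinfun_apply T x) x \<in> \<real>\<^sub>\<ge>\<^sub>0}"

text \<open>Neither the trace nor the trace class depends on the orthonormal basis that is used.\<close>

definition trace :: "('a::complex_hilbert_space \<Rightarrow>\<^sub>L 'a) \<Rightarrow> complex" where
  "trace T = (\<Sum>\<^sub>\<infinity>e\<in>some_onb. cinner (blinfun_apply T e) e)"

text \<open>$P = |T| = (T^*T)^{1/2}$, with $P^2 = T^*T$ expressed through the sesquilinear form
  $\langle T^*Tx, y\rangle = \langle Tx, Ty\rangle$.\<close>

definition is_abs_op ::
  "('a::complex_hilbert_space \<Rightarrow>\<^sub>L 'a) \<Rightarrow> ('a \<Rightarrow>\<^sub>L 'a) \<Rightarrow> bool" where
  "is_abs_op P T \<longleftrightarrow> P \<in> pos_ops \<and>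
     (\<forall>x y. cinner (blinfun_apply (P o\<^sub>L P) x) y = cinner (blinfun_apply T x) (blinfun_apply T y))"

definition trace_class :: "('a::complex_hilbert_space \<Rightarrow>\<^sub>L 'a) set" where
  "trace_class = {T \<in> bounded_ops.
     \<exists>P. is_abs_op P T \<and> (\<lambda>e. cinner (blinfun_apply P e) e) summable_on some_onb}"

definition pos_trace_class :: "('a::complex_hilbert_space \<Rightarrow>\<^sub>L 'a) set" where
  "pos_trace_class = trace_class \<inter> pos_ops"


section \<open>Non-negative definite functions\<close>

definition nonneg_definite_kernel ::
  "(int \<Rightarrow> int \<Rightarrow> 'a::complex_hilbert_space \<Rightarrow>\<^sub>L 'a) \<Rightarrow> bool" where
  "nonneg_definite_kernel c \<longleftrightarrow>
     (\<forall>(n::nat) (h::nat \<Rightarrow> int) (g::nat \<Rightarrow> 'a).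
        (\<Sum>i=1..n. \<Sum>j=1..n. cinner (blinfun_apply (c (h i) (h j)) (g j)) (g i)) \<in> \<real>\<^sub>\<ge>\<^sub>0)"

definition nonneg_definite :: "(int \<Rightarrow> 'a::complex_hilbert_space \<Rightarrow>\<^sub>L 'a) \<Rightarrow> bool" where
  "nonneg_definite \<Gamma> \<longleftrightarrow> nonneg_definite_kernel (\<lambda>i j. \<Gamma> (i - j))"


section \<open>Operator-valued measures\<close>

text \<open>The maps $S_1(H)^+ \to [0,\infty]$ are represented by functions that are \<^const>\<open>undefined\<close> off
  $S_1(H)^+$, so that equality of such maps is equality in the logic.\<close>

definition L_inf_plus :: "(('a::complex_hilbert_space \<Rightarrow>\<^sub>L 'a) \<Rightarrow> ennreal) set" where
  "L_inf_plus = {f \<in> pos_trace_class \<rightarrow>\<^sub>E UNIV.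
     (\<forall>A\<in>pos_trace_class. \<forall>B\<in>pos_trace_class. f (A + B) = f A + f B) \<and> f 0 = 0}"

text \<open>The identification of $B \in \mathcal{L}(H)^+$ with $A \mapsto \mathrm{tr}(BA)$; this trace is
  a non-negative real number, so that taking the real part and converting lose nothing.\<close>

definition op_as_map ::
  "('a::complex_hilbert_space \<Rightarrow>\<^sub>L 'a) \<Rightarrow> ('a \<Rightarrow>\<^sub>L 'a) \<Rightarrow> ennreal" where
  "op_as_map B = (\<lambda>A\<in>pos_trace_class. ennreal (Re (trace (B o\<^sub>L A))))"

definition borel_pi :: "real measure" where
  "borel_pi = restrict_space borel {-pi..pi}"

definition op_measure ::
  "(real set \<Rightarrow> ('a::complex_hilbert_space \<Rightarrow>\<^sub>L 'a) \<Rightarrow> ennreal) \<Rightarrow> bool" where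
  "op_measure F \<longleftrightarrow>
     F \<in> sets borel_pi \<rightarrow>\<^sub>E L_inf_plus \<and>
     F {} = op_as_map 0 \<and>
     (\<forall>E::nat \<Rightarrow> real set. range E \<subseteq> sets borel_pi \<longrightarrow> disjoint_family E \<longrightarrow>
        (\<forall>A\<in>pos_trace_class. F (\<Union>i. E i) A = (\<Sum>i. F (E i) A)))"

definition finite_op_measure ::
  "(real set \<Rightarrow> ('a::complex_hilbert_space \<Rightarrow>\<^sub>L 'a) \<Rightarrow> ennreal) \<Rightarrow> bool" where
  "finite_op_measure F \<longleftrightarrow> op_measure F \<and> F {-pi..pi} \<in> op_as_map ` pos_ops"

text \<open>The scalar measure $\mathscr{F}_A$.\<close>

definition scalar_measure ::
  "(real set \<Rightarrow> ('a::complex_hilbert_space \<Rightarrow>\<^sub>L 'a) \<Rightarrow> ennreal) \<Rightarrow> ('a \<Rightarrow>\<^sub>L 'a) \<Rightarrow> real measure" where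
  "scalar_measure F A = measure_of (space borel_pi) (sets borel_pi) (\<lambda>E. F E A)"

text \<open>\<open>has_op_integral F f T\<close> says that $T = \int f\,d\mathscr{F}$: the integral is the operator in
  $\mathcal{L}(H)$ determined by its traces against $S_1(H)^+$.\<close>

definition has_op_integral ::
  "(real set \<Rightarrow> ('a::complex_hilbert_space \<Rightarrow>\<^sub>L 'a) \<Rightarrow> ennreal) \<Rightarrow> (real \<Rightarrow> complex) \<Rightarrow>
     ('a \<Rightarrow>\<^sub>L 'a) \<Rightarrow> bool" where
  "has_op_integral F f T \<longleftrightarrow> T \<in> bounded_ops \<and>
     (\<forall>A\<in>pos_trace_class. trace (T o\<^sub>L A) = (\<integral>\<omega>. f \<omega> \<partial>scalar_measure F A))"

text \<open>\<open>F {-pi}\<close> is $\mathscr{F}(-\pi) = \mathscr{F}([-\pi,-\pi])$ in the distribution function notation.\<close>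

definition spectral_representation ::
  "(int \<Rightarrow> 'a::complex_hilbert_space \<Rightarrow>\<^sub>L 'a) \<Rightarrow>
     (real set \<Rightarrow> ('a \<Rightarrow>\<^sub>L 'a) \<Rightarrow> ennreal) \<Rightarrow> bool" where
  "spectral_representation \<Gamma> F \<longleftrightarrow>
     finite_op_measure F \<and> F {-pi} = op_as_map 0 \<and>
     (\<forall>h. has_op_integral F (\<lambda>\<omega>. exp (\<i> * of_int h * of_real \<omega>)) (\<Gamma> h))"

end

theory Submission
  imports "HOL-Probability.Levy" Defs
begin

text \<open>
  The measure is built one trace class operator at a time. If \<open>\<Gamma>\<close> is non-negative definite and
  \<open>A \<in> S\<^sub>1(H)\<^sup>+\<close>, then the scalar sequence \<open>h \<mapsto> tr (\<Gamma> h A)\<close> is non-negative definite, so by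
  Herglotz' theorem (\<open>herglotz\<close>) it is the sequence of Fourier coefficients of a finite measure
  \<open>\<mu>\<^sub>A\<close> without mass at \<open>-\<pi>\<close>, and one puts \<open>F E A = \<mu>\<^sub>A E\<close>. A value of \<open>F\<close> only has to be an additive
  map of \<open>A\<close>. As \<open>tr (\<Gamma> h A)\<close> is additive in \<open>A\<close>, this amounts to the fact that the Fourier
  coefficients determine a measure on the circle, in the additive form \<open>emeasure_add\<close>. The total
  mass is \<open>tr (\<Gamma> 0 A)\<close>, so \<open>F {-\<pi>..\<pi>}\<close> is the operator \<open>\<Gamma> 0\<close>. Uniqueness of \<open>F\<close> is the same fact,
  applied to the scalar measures of two representations.

  Positivity and additivity of the trace rest on \<open>trace_vector_expansion\<close>: the Cholesky
  algorithm, run along an orthonormal basis, writes a positive operator as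
  \<open>A x = (\<Sum>k. \<langle>x, v\<^sub>k\<rangle> v\<^sub>k)\<close>, and if \<open>A\<close> is trace class then \<open>(\<Sum>k. \<parallel>v\<^sub>k\<parallel>\<^sup>2)\<close> is finite and
  \<open>tr (T A) = (\<Sum>k. \<langle>T v\<^sub>k, v\<^sub>k\<rangle>)\<close> for every bounded operator \<open>T\<close>. Thus \<open>tr (\<Gamma> h A)\<close> is a sum of
  the non-negative definite sequences \<open>\<langle>\<Gamma> h v\<^sub>k, v\<^sub>k\<rangle>\<close>.

  Conversely, testing a representation on rank one operators shows that \<open>h \<mapsto> \<langle>\<Gamma> h x, x\<rangle>\<close> is
  non-negative definite for each single \<open>x\<close>. Non-negative definiteness of \<open>\<Gamma>\<close> involves several
  vectors at once; \<open>nonneg_definite_if_fejer_sum\<close> obtains it by applying the scalar statement to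
  the vectors \<open>(\<Sum>j. e\<^bsup>- i h\<^sub>j \<theta>\<^esup> g\<^sub>j)\<close> and averaging over \<open>\<theta>\<close>.

  In both directions positivity is used in one form only, namely that the Fejer sums
  \<open>(\<Sum>a,b\<le>N. \<gamma> (a - b) e\<^bsup>i (b - a) \<theta>\<^esup>)\<close> are non-negative.
\<close>

section \<open>Complex inner products and positive maps\<close>

instance complex_hilbert_space \<subseteq> banach ..

lemma scaleC_one [simp]: "1 *\<^sub>C (x::'a::complex_inner_space) = x"
  using scaleR_scaleC[of 1 x] by simp

lemma scaleC_zero_left [simp]: "0 *\<^sub>C (x::'a::complex_inner_space) = 0"
  using scaleR_scaleC[of 0 x] by simp

lemma scaleC_zero_right [simp]: "c *\<^sub>C (0::'a::complex_inner_space) = 0"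
  using scaleC_add_right[of c "0::'a" 0] by simp

lemma scaleC_minus_right: "c *\<^sub>C (- (x::'a::complex_inner_space)) = - (c *\<^sub>C x)"
  using scaleC_add_right[of c "- x" x] by (simp add: eq_neg_iff_add_eq_0)

lemma scaleC_diff_right: "c *\<^sub>C ((x::'a::complex_inner_space) - y) = c *\<^sub>C x - c *\<^sub>C y"
  using scaleC_add_right[of c x "- y"] by (simp add: scaleC_minus_right)

lemma cinner_add_right: "cinner (x::'a::complex_inner_space) (y + z) = cinner x y + cinner x z"
  by (metis cinner_add_left cinner_commute complex_cnj_add)

lemma cinner_scaleC_right: "cinner (x::'a::complex_inner_space) (c *\<^sub>C y) = cnj c * cinner x y"
  by (metis cinner_scaleC_left cinner_commute complex_cnj_mult)

lemma cinner_zero_left [simp]: "cinner (0::'a::complex_inner_space) x = 0"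
  using cinner_add_left[of "0::'a" 0 x] by simp

lemma cinner_zero_right [simp]: "cinner (x::'a::complex_inner_space) 0 = 0"
  using cinner_add_right[of x 0 0] by simp

lemma cinner_minus_left: "cinner (- (x::'a::complex_inner_space)) y = - cinner x y"
  using cinner_add_left[of "- x" x y] by (simp add: eq_neg_iff_add_eq_0)

lemma cinner_minus_right: "cinner (x::'a::complex_inner_space) (- y) = - cinner x y"
  using cinner_add_right[of x "- y" y] by (simp add: eq_neg_iff_add_eq_0)

lemma cinner_diff_left: "cinner ((x::'a::complex_inner_space) - y) z = cinner x z - cinner y z"
  using cinner_add_left[of x "- y" z] by (simp add: cinner_minus_left)

lemma cinner_diff_right: "cinner (x::'a::complex_inner_space) (y - z) = cinner x y - cinner x z"
  using cinner_add_right[of x y "- z"] by (simp add: cinner_minus_right)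

lemma cinner_scaleR_left: "cinner (r *\<^sub>R (x::'a::complex_inner_space)) y = of_real r * cinner x y"
  by (simp add: scaleR_scaleC cinner_scaleC_left)

lemma cinner_scaleR_right: "cinner (x::'a::complex_inner_space) (r *\<^sub>R y) = of_real r * cinner x y"
  by (simp add: scaleR_scaleC cinner_scaleC_right)

lemma cinner_sum_left: "cinner (\<Sum>i\<in>I. f i) (y::'a::complex_inner_space) = (\<Sum>i\<in>I. cinner (f i) y)"
  by (induction I rule: infinite_finite_induct) (auto simp: cinner_add_left)

lemma cinner_sum_right: "cinner (x::'a::complex_inner_space) (\<Sum>i\<in>I. f i) = (\<Sum>i\<in>I. cinner x (f i))"
  by (induction I rule: infinite_finite_induct) (auto simp: cinner_add_right)

lemmas cinner_linear_simps =
  cinner_add_left cinner_add_right cinner_diff_left cinner_diff_right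
  cinner_scaleC_left cinner_scaleC_right

text \<open>Plain functions rather than bounded operators, so that the identity map, which yields the
  Cauchy--Schwarz inequality of the inner product, and the residuals of the Cholesky recursion
  are covered.\<close>

definition positive_map :: "('a::complex_inner_space \<Rightarrow> 'a) \<Rightarrow> bool" where
  "positive_map f \<longleftrightarrow> (\<forall>x y. f (x + y) = f x + f y) \<and> (\<forall>c x. f (c *\<^sub>C x) = c *\<^sub>C f x) \<and>
     (\<forall>x. cinner (f x) x \<in> \<real>\<^sub>\<ge>\<^sub>0)"

lemma positive_mapD:
  assumes "positive_map f"
  shows "f (x + y) = f x + f y" "f (c *\<^sub>C x) = c *\<^sub>C f x" "cinner (f x) x \<in> \<real>\<^sub>\<ge>\<^sub>0"
    "f (x - y) = f x - f y" "f 0 = 0" "0 \<le> Re (cinner (f x) x)"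
proof -
  show 1: "f (x + y) = f x + f y" for x y using assms by (simp add: positive_map_def)
  show "f (c *\<^sub>C x) = c *\<^sub>C f x" using assms by (simp add: positive_map_def)
  show 3: "cinner (f x) x \<in> \<real>\<^sub>\<ge>\<^sub>0" for x using assms by (simp add: positive_map_def)
  show "f (x - y) = f x - f y" using 1[of "x - y" y] by (simp add: algebra_simps)
  show "f 0 = 0" using 1[of 0 0] by simp
  show "0 \<le> Re (cinner (f x) x)" using 3[of x] by (auto simp: complex_nonneg_Reals_iff)
qed

lemma positive_map_form_real:
  assumes "positive_map f"
  shows "cinner (f x) x = of_real (Re (cinner (f x) x))"
  using positive_mapD(3)[OF assms, of x] by (auto simp: complex_nonneg_Reals_iff complex_eq_iff)

lemma positive_map_id: "positive_map (\<lambda>x. x)"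
  by (auto simp: positive_map_def cinner_self_norm)

text \<open>The form \<open>\<langle>f z, z\<rangle>\<close> is real; comparing imaginary parts at \<open>x + y\<close> and at \<open>x + \<i> y\<close> shows that
  the sesquilinear form is Hermitian.\<close>

lemma positive_map_symmetric:
  assumes "positive_map f"
  shows "cinner (f x) y = cinner x (f y)"
proof -
  note D = positive_mapD[OF assms]
  have im: "Im (cinner (f z) z) = 0" for z
    using D(3)[of z] by (auto simp: complex_nonneg_Reals_iff)
  have 1: "Im (cinner (f x) y + cinner (f y) x) = 0" for x y
    using im[of "x + y"] im[of x] im[of y] by (simp add: D cinner_linear_simps)
  have 2: "Im (cinner (f x) (\<i> *\<^sub>C y) + cinner (f (\<i> *\<^sub>C y)) x) = 0" by (rule 1)
  have "cinner (f x) y = cnj (cinner (f y) x)"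
    using 1[of x y] 2 by (simp add: D cinner_linear_simps complex_eq_iff)
  then show ?thesis by (metis cinner_commute)
qed

text \<open>With \<open>b = \<langle>f x, y\<rangle>\<close>, the form at \<open>x - r b y\<close> is a quadratic polynomial in the real number
  \<open>r\<close> that is never negative. Its value at \<open>r = 1 / \<langle>f y, y\<rangle>\<close> gives the inequality, and if
  \<open>\<langle>f y, y\<rangle> = 0\<close> a large \<open>r\<close> forces \<open>b = 0\<close>.\<close>

lemma positive_map_Cauchy_Schwarz:
  assumes "positive_map f"
  shows "(cmod (cinner (f x) y))\<^sup>2 \<le> Re (cinner (f x) x) * Re (cinner (f y) y)"
proof -
  note D = positive_mapD[OF assms]
  define a b c where "a = Re (cinner (f x) x)" and "b = cinner (f x) y" and "c = Re (cinner (f y) y)"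
  have a: "cinner (f x) x = of_real a" and c: "cinner (f y) y = of_real c" and c0: "0 \<le> c" and a0: "0 \<le> a"
    unfolding a_def c_def using D(6) positive_map_form_real[OF assms] by auto
  have b': "cinner (f y) x = cnj b"
    unfolding b_def by (metis positive_map_symmetric[OF assms] cinner_commute)
  have bb: "Re (b * cnj b) = (cmod b)\<^sup>2" "Im (b * cnj b) = 0"
    by (metis Re_complex_of_real complex_norm_square, simp)
  have key: "0 \<le> a - 2 * r * (cmod b)\<^sup>2 + r\<^sup>2 * (cmod b)\<^sup>2 * c" for r :: real
  proof -
    have re: "Re (of_real s * z) = s * Re z" for s z by simp
    let ?t = "of_real r * b"
    have "cinner (f (x - ?t *\<^sub>C y)) (x - ?t *\<^sub>C y)
        = of_real a - of_real r * (b * cnj b) - of_real r * (b * cnj b)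
          + of_real (r * r * c) * (b * cnj b)"
      by (simp add: D cinner_linear_simps a c b' b_def[symmetric] algebra_simps)
    then have "Re (cinner (f (x - ?t *\<^sub>C y)) (x - ?t *\<^sub>C y)) =
        a - r * (cmod b)\<^sup>2 - r * (cmod b)\<^sup>2 + (r * r * c) * (cmod b)\<^sup>2"
      by (simp only: minus_complex.sel plus_complex.sel Re_complex_of_real re bb)
    with D(6)[of "x - ?t *\<^sub>C y"] show ?thesis by (simp add: power2_eq_square algebra_simps)
  qed
  have "(cmod b)\<^sup>2 \<le> a * c"
  proof (cases "c = 0")
    case True
    have "(cmod b)\<^sup>2 = 0"
    proof (rule ccontr)
      assume "(cmod b)\<^sup>2 \<noteq> 0"
      then have "(cmod b)\<^sup>2 > 0" by simp
      with key[of "(a + 1) / (cmod b)\<^sup>2"] True a0 show False by simp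
    qed
    then show ?thesis using True by simp
  next
    case False
    with c0 have "c > 0" by simp
    with key[of "1 / c"] show ?thesis by (simp add: field_simps power2_eq_square)
  qed
  then show ?thesis unfolding a_def b_def c_def .
qed

lemma cmod_cinner_le: "cmod (cinner (x::'a::complex_inner_space) y) \<le> norm x * norm y"
  using positive_map_Cauchy_Schwarz[OF positive_map_id, of x y]
  by (simp add: cinner_self_norm power_mult_distrib[symmetric] abs_le_square_iff[symmetric] del: of_real_power)

text \<open>Cauchy--Schwarz for the pair \<open>x\<close>, \<open>f x\<close>.\<close>

lemma positive_map_norm_le:
  assumes f: "positive_map f" and M: "\<And>x. Re (cinner (f x) x) \<le> M * (norm x)\<^sup>2" "0 \<le> M"
  shows "norm (f x) \<le> M * norm x"
proof (cases "f x = 0")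
  case True
  then show ?thesis using M by simp
next
  case False
  have "(norm (f x))\<^sup>2 * (norm (f x))\<^sup>2 = (cmod (cinner (f x) (f x)))\<^sup>2"
    by (simp add: cinner_self_norm norm_power power2_eq_square norm_mult)
  also have "\<dots> \<le> Re (cinner (f x) x) * Re (cinner (f (f x)) (f x))"
    by (rule positive_map_Cauchy_Schwarz[OF f])
  also have "\<dots> \<le> (M * (norm x)\<^sup>2) * (M * (norm (f x))\<^sup>2)"
    by (intro mult_mono M positive_mapD[OF f]) (simp add: M)
  also have "\<dots> = (M * norm x)\<^sup>2 * (norm (f x))\<^sup>2" by (simp add: power2_eq_square)
  finally have "(norm (f x))\<^sup>2 \<le> (M * norm x)\<^sup>2"
    by (rule mult_right_le_imp_le) (use False in simp)
  then show ?thesis using M(2) by (simp add: abs_le_square_iff[symmetric])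
qed

lemma bounded_opsD:
  assumes "T \<in> bounded_ops"
  shows "blinfun_apply T (c *\<^sub>C x) = c *\<^sub>C blinfun_apply T x"
  using assms by (simp add: bounded_ops_def)

lemma pos_ops_iff: "T \<in> pos_ops \<longleftrightarrow> positive_map (blinfun_apply T)"
  by (auto simp: pos_ops_def bounded_ops_def positive_map_def blinfun.add_right)

lemma bounded_op_form_bound:
  "Re (cinner (blinfun_apply T x) x) \<le> norm T * (norm (x::'a::complex_hilbert_space))\<^sup>2"
proof -
  have "Re (cinner (blinfun_apply T x) x) \<le> norm (blinfun_apply T x) * norm x"
    using complex_Re_le_cmod cmod_cinner_le order_trans by blast
  also have "\<dots> \<le> (norm T * norm x) * norm x"
    by (intro mult_right_mono norm_blinfun) simp
  finally show ?thesis by (simp add: power2_eq_square)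
qed

section \<open>Domination by the absolute value and the trace class\<close>

text \<open>In particular \<open>A\<close> is dominated by every positive \<open>P\<close> with \<open>P\<^sup>2 = A\<^sup>2\<close>. Put \<open>D = A - P\<close> and
  \<open>Q = A + P\<close>, so that \<open>D \<le> Q\<close> and the assumption says \<open>Re \<langle>Q x, D x\<rangle> = 0\<close>. Suppose that
  \<open>m = sup \<langle>D x, x\<rangle>\<close> over the unit sphere is positive. Unit vectors that nearly attain the supremum
  are approximate eigenvectors of \<open>D\<close> for \<open>m\<close>, because \<open>m - D\<close> is positive. For them
  \<open>m \<langle>Q x, x\<rangle>\<close> is close to \<open>Re \<langle>Q x, D x\<rangle> = 0\<close>, whereas \<open>\<langle>Q x, x\<rangle> \<ge> \<langle>D x, x\<rangle>\<close> is close to \<open>m\<close>.\<close>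

lemma positive_map_le_of_norm_eq:
  fixes P A :: "'a::complex_hilbert_space \<Rightarrow>\<^sub>L 'a"
  assumes P: "P \<in> pos_ops" and A: "A \<in> pos_ops"
    and eq: "\<And>x. norm (blinfun_apply A x) = norm (blinfun_apply P x)"
  shows "Re (cinner (blinfun_apply A x) x) \<le> Re (cinner (blinfun_apply P x) x)"
proof -
  have pA: "positive_map (blinfun_apply A)" and pP: "positive_map (blinfun_apply P)"
    using P A by (auto simp: pos_ops_iff)
  note DA = positive_mapD[OF pA] and DP = positive_mapD[OF pP]
  define d where "d x = Re (cinner (blinfun_apply A x) x) - Re (cinner (blinfun_apply P x) x)" for x
  define q where "q x = Re (cinner (blinfun_apply A x) x) + Re (cinner (blinfun_apply P x) x)" for x
  define S where "S = (\<lambda>x. d x) ` {x. norm x = 1}"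
  have d_le: "d x \<le> q x" for x using DP(6)[of x] by (simp add: d_def q_def)
  have bdd: "bdd_above S"
  proof (rule bdd_aboveI)
    fix s assume "s \<in> S"
    then obtain x where "norm x = 1" "s = d x" by (auto simp: S_def)
    then show "s \<le> norm A" using bounded_op_form_bound[of A x] DP(6)[of x] by (simp add: d_def)
  qed
  have d_scale: "d (r *\<^sub>R x) = r\<^sup>2 * d x" for r x
    by (simp add: d_def blinfun.scaleR_right cinner_scaleR_left cinner_scaleR_right power2_eq_square algebra_simps)
  show ?thesis
  proof (rule ccontr)
    assume "\<not> ?thesis"
    then have dx: "d x > 0" by (simp add: d_def)
    then have "x \<noteq> 0" by (auto simp: d_def)
    define u where "u = (1 / norm x) *\<^sub>R x"
    have "norm u = 1" "d u > 0" using \<open>x \<noteq> 0\<close> dx by (auto simp: u_def d_scale)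
    then have uS: "d u \<in> S" by (auto simp: S_def)
    define m where "m = Sup S"
    have m: "0 < m" using cSup_upper[OF uS bdd] \<open>d u > 0\<close> by (simp add: m_def)
    have dm: "d y \<le> m * (norm y)\<^sup>2" for y
    proof (cases "y = 0")
      case False
      have "d ((1 / norm y) *\<^sub>R y) \<le> m"
        unfolding m_def by (rule cSup_upper[OF _ bdd]) (use False in \<open>auto simp: S_def\<close>)
      with False show ?thesis unfolding d_scale by (simp add: field_simps)
    qed (simp add: d_def)
    \<comment> \<open>The positive map \<open>m - D\<close>.\<close>
    define g where "g x = m *\<^sub>R x - (blinfun_apply A x - blinfun_apply P x)" for x
    have g_form: "cinner (g x) x = of_real (m * (norm x)\<^sup>2 - d x)" for x
      using positive_map_form_real[OF pA, of x] positive_map_form_real[OF pP, of x]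
      by (simp add: g_def d_def cinner_diff_left cinner_scaleR_left cinner_self_norm)
    have pg: "positive_map g"
      unfolding positive_map_def
    proof (intro conjI allI)
      show "g (x + y) = g x + g y" for x y
        by (simp add: g_def DA DP algebra_simps)
      show "g (c *\<^sub>C x) = c *\<^sub>C g x" for c x
        by (simp add: g_def DA DP scaleC_diff_right scaleR_scaleC scaleC_scaleC mult.commute)
      show "cinner (g x) x \<in> \<real>\<^sub>\<ge>\<^sub>0" for x
        unfolding g_form using dm[of x] by (simp only: nonneg_Reals_of_real_iff)
    qed
    have ab: "Re (cinner (blinfun_apply A x + blinfun_apply P x) (blinfun_apply A x - blinfun_apply P x)) = 0" for x
      by (simp add: cinner_linear_simps cinner_self_norm eq)
        (metis cinner_commute cnj.simps(1))
    \<comment> \<open>\<open>m - D \<le> m + P\<close>, because \<open>A\<close> is positive.\<close>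
    define K where "K = m + norm P"
    have gK: "Re (cinner (g x) x) \<le> K * (norm x)\<^sup>2" for x
    proof -
      have "Re (cinner (g x) x) = m * (norm x)\<^sup>2 - d x" by (simp add: g_form)
      also have "\<dots> \<le> m * (norm x)\<^sup>2 + norm P * (norm x)\<^sup>2"
        using bounded_op_form_bound[of P x] DA(6)[of x] by (simp add: d_def)
      finally show ?thesis by (simp add: K_def algebra_simps)
    qed
    have K0: "K > 0" using m by (simp add: K_def add_pos_nonneg)
    define L where "L = norm A + norm P"
    \<comment> \<open>Since \<open>\<parallel>(m - D) y\<parallel>\<^sup>2 \<le> K \<langle>(m - D) y, y\<rangle>\<close>, the vector \<open>y\<close> is nearly an eigenvector
      when \<open>d y\<close> is close to \<open>m\<close>.\<close>
    have main: "m * d y \<le> L * sqrt (K * (m - d y))" if y: "norm y = 1" for y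
    proof -
      have "norm (g y) ^ 2 * norm (g y) ^ 2 = (cmod (cinner (g y) (g y)))\<^sup>2"
        by (simp add: cinner_self_norm norm_power power2_eq_square norm_mult)
      also have "\<dots> \<le> Re (cinner (g y) y) * Re (cinner (g (g y)) (g y))"
        by (rule positive_map_Cauchy_Schwarz[OF pg])
      also have "\<dots> \<le> (m - d y) * (K * (norm (g y))\<^sup>2)"
        using gK[of "g y"] dm[of y] dm[of "g y"] y by (intro mult_mono) (auto simp: g_form)
      finally have *: "norm (g y) ^ 2 * norm (g y) ^ 2 \<le> (K * (m - d y)) * norm (g y) ^ 2"
        by (simp add: algebra_simps)
      have "norm (g y) ^ 2 \<le> K * (m - d y)"
      proof (cases "g y = 0")
        case True then show ?thesis using dm[of y] y K0 by simp
      next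
        case False
        show ?thesis by (rule mult_right_le_imp_le[OF *]) (use False in simp)
      qed
      then have ng: "norm (g y) \<le> sqrt (K * (m - d y))" by (simp add: real_le_rsqrt)
      have "m * d y \<le> m * q y" using d_le m by simp
      also have "\<dots> = Re (cinner (blinfun_apply A y + blinfun_apply P y) (m *\<^sub>R y))"
        by (simp add: cinner_scaleR_right q_def cinner_add_left)
      also have "\<dots> = Re (cinner (blinfun_apply A y + blinfun_apply P y) (g y))"
        using ab[of y] unfolding g_def by (simp add: cinner_diff_right)
      also have "\<dots> \<le> norm (blinfun_apply A y + blinfun_apply P y) * norm (g y)"
        using complex_Re_le_cmod cmod_cinner_le order_trans by blast
      also have "\<dots> \<le> L * sqrt (K * (m - d y))"
      proof (intro mult_mono ng)
        show "norm (blinfun_apply A y + blinfun_apply P y) \<le> L"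
          using norm_triangle_ineq[of "blinfun_apply A y" "blinfun_apply P y"] norm_blinfun[of A y] norm_blinfun[of P y] y
          by (simp add: L_def)
      qed (auto simp: L_def)
      finally show ?thesis .
    qed
    have "\<exists>y. norm y = 1 \<and> m - 1 / real (Suc n) < d y" for n
    proof -
      have "\<exists>s\<in>S. m - 1 / real (Suc n) < s"
        using less_cSup_iff[of S "m - 1 / real (Suc n)"] uS bdd by (auto simp: m_def)
      then show ?thesis by (auto simp: S_def)
    qed
    then obtain y where y: "\<And>n. norm (y n) = 1" "\<And>n. m - 1 / real (Suc n) < d (y n)" by metis
    have lim: "(\<lambda>n. d (y n)) \<longlonglongrightarrow> m"
    proof (rule tendsto_sandwich)
      show "(\<lambda>n. m - 1 / real (Suc n)) \<longlonglongrightarrow> m"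
        using tendsto_diff[OF tendsto_const LIMSEQ_Suc[OF lim_1_over_n]] by simp
      show "\<forall>\<^sub>F n in sequentially. d (y n) \<le> m" using dm[of "y _"] y by simp
      show "\<forall>\<^sub>F n in sequentially. m - 1 / real (Suc n) \<le> d (y n)"
        using y(2) by (intro always_eventually allI less_imp_le)
    qed auto
    have "m * m \<le> L * sqrt (K * (m - m))"
      by (rule LIMSEQ_le[OF tendsto_mult[OF tendsto_const lim]
            tendsto_mult[OF tendsto_const tendsto_real_sqrt[OF tendsto_mult[OF tendsto_const
              tendsto_diff[OF tendsto_const lim]]]]]) (use main y in auto)
    with m show False by (simp add: mult_le_0_iff)
  qed
qed

text \<open>An absolute value of \<open>A\<close> is given only through its square. Domination by it bounds the
  diagonal of \<open>A\<close>; in the other direction \<open>A\<close> itself serves as an absolute value.\<close>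

lemma pos_trace_class_iff:
  "A \<in> pos_trace_class \<longleftrightarrow>
     A \<in> pos_ops \<and> (\<lambda>e. cinner (blinfun_apply A e) e) summable_on some_onb"
proof
  assume "A \<in> pos_trace_class"
  then obtain P where A: "A \<in> pos_ops" and P: "is_abs_op P A"
    and sP: "(\<lambda>e. cinner (blinfun_apply P e) e) summable_on some_onb"
    by (auto simp: pos_trace_class_def trace_class_def)
  have pP: "P \<in> pos_ops" using P by (simp add: is_abs_op_def)
  have "norm (blinfun_apply A x) = norm (blinfun_apply P x)" for x
  proof -
    have "cinner (blinfun_apply P (blinfun_apply P x)) x = cinner (blinfun_apply A x) (blinfun_apply A x)"
      using P by (simp add: is_abs_op_def)
    then have "cinner (blinfun_apply P x) (blinfun_apply P x) = cinner (blinfun_apply A x) (blinfun_apply A x)"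
      using pP positive_map_symmetric by (metis pos_ops_iff)
    then show ?thesis by (simp add: cinner_self_norm del: of_real_power)
  qed
  then have le: "Re (cinner (blinfun_apply A x) x) \<le> Re (cinner (blinfun_apply P x) x)" for x
    by (intro positive_map_le_of_norm_eq pP A)
  have "(\<lambda>e. cmod (cinner (blinfun_apply A e) e)) summable_on some_onb"
  proof (rule Infinite_Sum.abs_summable_on_comparison_test)
    show "(\<lambda>e. cmod (cinner (blinfun_apply P e) e)) summable_on some_onb"
      using sP by (simp add: summable_on_iff_abs_summable_on_complex)
    fix e
    have "positive_map (blinfun_apply A)" "positive_map (blinfun_apply P)"
      using A pP by (auto simp: pos_ops_iff)
    then show "cmod (cinner (blinfun_apply A e) e) \<le> cmod (cinner (blinfun_apply P e) e)"
      using le[of e] positive_map_form_real[of "blinfun_apply A" e] positive_map_form_real[of "blinfun_apply P" e]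
        positive_mapD(6)[of "blinfun_apply A" e] positive_mapD(6)[of "blinfun_apply P" e]
      by (metis abs_of_nonneg norm_of_real)
  qed
  then show "A \<in> pos_ops \<and> (\<lambda>e. cinner (blinfun_apply A e) e) summable_on some_onb"
    using A by (simp add: summable_on_iff_abs_summable_on_complex)
next
  assume A: "A \<in> pos_ops \<and> (\<lambda>e. cinner (blinfun_apply A e) e) summable_on some_onb"
  then have "is_abs_op A A"
    using positive_map_symmetric by (auto simp: is_abs_op_def pos_ops_iff)
  with A show "A \<in> pos_trace_class"
    by (auto simp: pos_trace_class_def trace_class_def pos_ops_def)
qed

lemma pos_ops_add: "A \<in> pos_ops \<Longrightarrow> B \<in> pos_ops \<Longrightarrow> A + B \<in> pos_ops"
  by (auto simp: pos_ops_def bounded_ops_def blinfun.add_left cinner_add_left scaleC_add_right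
      intro: nonneg_Reals_add_I)

lemma pos_trace_class_add:
  assumes "A \<in> pos_trace_class" "B \<in> pos_trace_class"
  shows "A + B \<in> pos_trace_class"
  using assms summable_on_add[of "\<lambda>e. cinner (blinfun_apply A e) e" some_onb "\<lambda>e. cinner (blinfun_apply B e) e"]
  by (auto simp: pos_trace_class_iff pos_ops_add blinfun.add_left cinner_add_left)

lemma zero_pos_trace_class: "0 \<in> pos_trace_class"
  by (simp add: pos_trace_class_iff pos_ops_def bounded_ops_def)

section \<open>Orthonormal bases of separable spaces\<close>

lemma is_onb_some_onb: "is_onb (some_onb :: 'a::complex_inner_space set)"
proof -
  define ON :: "'a set \<Rightarrow> bool"
    where "ON B \<longleftrightarrow> (\<forall>x\<in>B. \<forall>y\<in>B. cinner x y = (if x = y then 1 else 0))" for B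
  have "\<exists>M\<in>Collect ON. \<forall>X\<in>Collect ON. M \<subseteq> X \<longrightarrow> X = M"
  proof (rule subset_Zorn')
    fix C assume C: "subset.chain (Collect ON) C"
    have "ON (\<Union>C)"
      unfolding ON_def
    proof (intro ballI)
      fix x y assume "x \<in> \<Union>C" "y \<in> \<Union>C"
      then obtain X Y where x: "x \<in> X" "X \<in> C" and y: "y \<in> Y" "Y \<in> C" by (elim UnionE)
      have A: "ON X" "ON Y" and "X \<subseteq> Y \<or> Y \<subseteq> X"
        using C x(2) y(2) by (auto simp: subset_chain_def)
      then consider "x \<in> Y" | "y \<in> X" using x(1) y(1) by (meson subsetD)
      then show "cinner x y = (if x = y then 1 else 0)"
        using A x(1) y(1) unfolding ON_def by cases auto
    qed
    then show "\<Union>C \<in> Collect ON" by simp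
  qed
  then obtain M where M: "ON M" and max: "\<And>X. ON X \<Longrightarrow> M \<subseteq> X \<Longrightarrow> X = M" by auto
  have "is_onb M"
    unfolding is_onb_def
  proof (intro conjI allI impI)
    show "\<forall>x\<in>M. \<forall>y\<in>M. cinner x y = (if x = y then 1 else 0)" using M by (simp add: ON_def)
    fix x assume x: "\<forall>e\<in>M. cinner x e = 0"
    show "x = 0"
    proof (rule ccontr)
      assume "x \<noteq> 0"
      define u where "u = (1 / norm x) *\<^sub>R x"
      have uu: "cinner u u = 1" using \<open>x \<noteq> 0\<close>
        by (simp add: u_def cinner_self_norm)
      have ue: "cinner u e = 0" if "e \<in> M" for e
        using x that by (simp add: u_def cinner_scaleR_left)
      have eu: "cinner e u = 0" if "e \<in> M" for e
        using ue[OF that] cinner_commute[of e u] by simp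
      have "u \<notin> M" using ue[of u] uu by auto
      moreover have "ON (insert u M)"
        using M uu ue eu \<open>u \<notin> M\<close> by (auto simp: ON_def)
      ultimately show False using max[of "insert u M"] by blast
    qed
  qed
  then show ?thesis unfolding some_onb_def by (rule someI)
qed

lemma orthonormal_dist:
  fixes x y :: "'a::complex_inner_space"
  assumes "cinner x x = 1" "cinner y y = 1" "cinner x y = 0"
  shows "dist x y = sqrt 2"
proof -
  have "cinner y x = 0" using assms(3) cinner_commute[of y x] by simp
  then have "cinner (x - y) (x - y) = 2" using assms by (simp add: cinner_linear_simps)
  then have "complex_of_real ((norm (x - y))\<^sup>2) = of_real 2" by (simp add: cinner_self_norm)
  then have "(norm (x - y))\<^sup>2 = 2" unfolding of_real_eq_iff .
  then show ?thesis by (metis dist_norm norm_ge_zero real_sqrt_unique)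
qed

text \<open>Distinct basis vectors are at distance \<open>\<surd>2\<close>, so that approximating each of them within \<open>1/2\<close>
  by a member of a countable dense set is injective.\<close>

lemma countable_some_onb:
  assumes "separable_space (euclidean :: 'a topology)"
  shows "countable (some_onb :: 'a::complex_inner_space set)"
proof -
  obtain S :: "'a set" where S: "countable S" "closure S = UNIV"
    using assms by (auto simp: separable_space_def)
  have "\<exists>s\<in>S. dist s x < 1/2" for x
    by (rule closure_approachable[of x S, THEN iffD1, rule_format]) (simp_all add: S)
  then obtain s where s: "\<And>x. s x \<in> S" "\<And>x. dist (s x) x < 1/2" by metis
  have "inj_on s some_onb"
  proof (rule inj_onI, rule ccontr)
    fix x y :: 'a assume xy: "x \<in> some_onb" "y \<in> some_onb" "s x = s y" "x \<noteq> y"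
    have "dist x y = sqrt 2"
      using xy is_onb_some_onb by (intro orthonormal_dist) (auto simp: is_onb_def)
    moreover have "dist x y < 1"
      using dist_triangle2[of x y "s x"] s(2)[of x] s(2)[of y] xy(3) by (simp add: dist_commute)
    ultimately show False by (simp add: real_less_lsqrt)
  qed
  then show ?thesis
    using S(1) s(1) by (meson countable_image_inj_on countable_subset image_subsetI)
qed

text \<open>Zero entries are allowed, so that bases of any finite or countable size are indexed by all of
  \<open>nat\<close>.\<close>

definition onb_seq :: "(nat \<Rightarrow> 'a::complex_inner_space) \<Rightarrow> bool" where
  "onb_seq e \<longleftrightarrow> (\<forall>i j. i \<noteq> j \<longrightarrow> cinner (e i) (e j) = 0) \<and> (\<forall>i. e i = 0 \<or> norm (e i) = 1) \<and>
     (\<forall>x. (\<forall>i. cinner x (e i) = 0) \<longrightarrow> x = 0)"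

text \<open>The second property turns sums over the basis, in particular traces, into sums over \<open>nat\<close>: the
  padding by zeros contributes nothing when \<open>f 0 = 0\<close>.\<close>

lemma obtain_onb_seq:
  assumes "separable_space (euclidean :: 'a topology)"
  obtains e :: "nat \<Rightarrow> 'a::complex_inner_space" where "onb_seq e"
    "\<And>(f :: 'a \<Rightarrow> complex) s. f 0 = 0 \<Longrightarrow> (f has_sum s) some_onb \<longleftrightarrow> ((\<lambda>n. f (e n)) has_sum s) UNIV"
proof
  let ?B = "some_onb :: 'a set"
  let ?I = "to_nat_on ?B ` ?B"
  define e where "e n = (if n \<in> ?I then from_nat_into ?B n else 0)" for n
  have cB: "countable ?B" by (rule countable_some_onb[OF assms])
  have e_B: "e n \<in> ?B" if "n \<in> ?I" for n using that cB by (auto simp: e_def)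
  have e_to: "e (to_nat_on ?B b) = b" if "b \<in> ?B" for b using that cB by (simp add: e_def)
  have B: "\<And>x y. x \<in> ?B \<Longrightarrow> y \<in> ?B \<Longrightarrow> cinner x y = (if x = y then 1 else 0)"
    "\<And>x. (\<And>b. b \<in> ?B \<Longrightarrow> cinner x b = 0) \<Longrightarrow> x = 0"
    using is_onb_some_onb[where 'a='a] by (auto simp: is_onb_def)
  have inj: "inj_on e ?I"
  proof (rule inj_on_inverseI)
    fix i assume "i \<in> ?I"
    then obtain b where "b \<in> ?B" "i = to_nat_on ?B b" by blast
    then show "to_nat_on ?B (e i) = i" by (simp only: e_to)
  qed
  have im: "e ` ?I = ?B"
    unfolding image_image using e_to by (simp cong: image_cong_simp)
  show "onb_seq e"
    unfolding onb_seq_def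
  proof (intro conjI allI impI)
    fix i j :: nat assume "i \<noteq> j"
    show "cinner (e i) (e j) = 0"
    proof (cases "i \<in> ?I \<and> j \<in> ?I")
      case True
      then have "e i \<noteq> e j" using inj \<open>i \<noteq> j\<close> by (meson inj_onD)
      then show ?thesis using True e_B B(1) by simp
    qed (auto simp: e_def)
  next
    fix i show "e i = 0 \<or> norm (e i) = 1"
    proof (cases "i \<in> ?I")
      case True
      then have "complex_of_real ((norm (e i))\<^sup>2) = of_real 1"
        using B(1)[OF e_B e_B, of i i] by (simp add: cinner_self_norm)
      then have "(norm (e i))\<^sup>2 = 1" unfolding of_real_eq_iff .
      then show ?thesis unfolding power2_eq_1_iff using norm_ge_zero[of "e i"] by linarith
    qed (simp add: e_def)
  next
    fix x assume "\<forall>i. cinner x (e i) = 0"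
    show "x = 0"
    proof (rule B(2))
      fix b assume "b \<in> ?B"
      then show "cinner x b = 0"
        using \<open>\<forall>i. cinner x (e i) = 0\<close> e_to[of b] by (metis (mono_tags))
    qed
  qed
  fix f :: "'a \<Rightarrow> complex" and s assume f0: "f 0 = 0"
  have "(f has_sum s) ?B \<longleftrightarrow> ((f \<circ> e) has_sum s) ?I"
    using has_sum_reindex[OF inj, of f s] by (simp add: im)
  also have "\<dots> \<longleftrightarrow> ((\<lambda>n. f (e n)) has_sum s) UNIV"
    by (rule has_sum_cong_neutral) (auto simp: e_def f0)
  finally show "(f has_sum s) ?B \<longleftrightarrow> ((\<lambda>n. f (e n)) has_sum s) UNIV" .
qed

lemma cinner_mult_swap:
  "cinner (x::'a::complex_inner_space) y * cinner y x = of_real ((cmod (cinner x y))\<^sup>2)"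
  by (simp only: complex_norm_square cinner_commute[of y x])

context
  fixes e :: "nat \<Rightarrow> 'a::complex_hilbert_space"
  assumes e: "onb_seq e"
begin

lemma onb_seq_cinner: "cinner (e i) (e j) = (if i = j \<and> e i \<noteq> 0 then 1 else 0)"
  using e by (auto simp: onb_seq_def cinner_self_norm)

lemma onb_seq_norm_le: "norm (e i) \<le> 1"
proof -
  have "e i = 0 \<or> norm (e i) = 1" using e by (simp add: onb_seq_def)
  then show ?thesis by auto
qed

lemma onb_partial_sum_cinner:
  assumes "j < n"
  shows "cinner (x - (\<Sum>i<n. cinner x (e i) *\<^sub>C e i)) (e j) = 0"
proof -
  have "cinner (\<Sum>i<n. cinner x (e i) *\<^sub>C e i) (e j) = (\<Sum>i<n. if i = j then cinner x (e j) else 0)"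
    unfolding cinner_sum_left cinner_scaleC_left by (intro sum.cong) (auto simp: onb_seq_cinner)
  then show ?thesis using assms by (simp add: cinner_diff_left)
qed

lemma onb_partial_sum_norm:
  "(norm (x - (\<Sum>i<n. cinner x (e i) *\<^sub>C e i)))\<^sup>2 = (norm x)\<^sup>2 - (\<Sum>i<n. (cmod (cinner x (e i)))\<^sup>2)"
proof -
  let ?s = "\<Sum>i<n. cinner x (e i) *\<^sub>C e i"
  have "cinner (x - ?s) ?s = 0"
    by (simp add: cinner_sum_right cinner_scaleC_right onb_partial_sum_cinner)
  then have "cinner (x - ?s) (x - ?s) = cinner (x - ?s) x" by (simp add: cinner_diff_right)
  also have "\<dots> = cinner x x - (\<Sum>i<n. cinner x (e i) * cinner (e i) x)"
    by (simp add: cinner_diff_left cinner_sum_left cinner_scaleC_left)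
  also have "(\<Sum>i<n. cinner x (e i) * cinner (e i) x) = (\<Sum>i<n. of_real ((cmod (cinner x (e i)))\<^sup>2))"
    by (intro sum.cong refl cinner_mult_swap)
  finally have "complex_of_real ((norm (x - ?s))\<^sup>2) = of_real ((norm x)\<^sup>2 - (\<Sum>i<n. (cmod (cinner x (e i)))\<^sup>2))"
    by (simp add: cinner_self_norm)
  then show ?thesis unfolding of_real_eq_iff .
qed

text \<open>By Bessel's inequality the partial sums form a Cauchy sequence; the difference of \<open>x\<close> and
  their limit is orthogonal to the whole basis and vanishes by maximality.\<close>

lemma onb_expansion: "(\<lambda>i. cinner x (e i) *\<^sub>C e i) sums x"
proof -
  let ?t = "\<lambda>i. cinner x (e i) *\<^sub>C e i"
  have bessel: "(\<Sum>i<n. (cmod (cinner x (e i)))\<^sup>2) \<le> (norm x)\<^sup>2" for n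
    using onb_partial_sum_norm[of x n] by (smt (verit) zero_le_power2)
  have "summable (\<lambda>i. (cmod (cinner x (e i)))\<^sup>2)"
    by (rule summableI_nonneg_bounded[OF _ bessel]) simp
  have pyth: "(norm (\<Sum>i\<in>{m..<n}. ?t i))\<^sup>2 \<le> (\<Sum>i\<in>{m..<n}. (cmod (cinner x (e i)))\<^sup>2)" for m n
  proof -
    have "cinner (\<Sum>i\<in>{m..<n}. ?t i) (\<Sum>i\<in>{m..<n}. ?t i)
        = (\<Sum>i\<in>{m..<n}. \<Sum>j\<in>{m..<n}. if j = i then (if e i = 0 then 0 else cinner x (e i) * cnj (cinner x (e i))) else 0)"
      unfolding cinner_sum_left unfolding cinner_sum_right
      by (intro sum.cong refl) (auto simp: onb_seq_cinner cinner_scaleC_left cinner_scaleC_right)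
    also have "\<dots> = (\<Sum>i\<in>{m..<n}. of_real ((cmod (cinner x (e i)))\<^sup>2))"
      by (intro sum.cong) (auto simp: complex_norm_square[symmetric] simp del: of_real_power)
    finally have "complex_of_real ((norm (\<Sum>i\<in>{m..<n}. ?t i))\<^sup>2) = of_real (\<Sum>i\<in>{m..<n}. (cmod (cinner x (e i)))\<^sup>2)"
      by (simp add: cinner_self_norm)
    then show ?thesis unfolding of_real_eq_iff by simp
  qed
  have "summable ?t"
    unfolding summable_Cauchy
  proof (intro allI impI)
    fix r :: real assume "r > 0"
    then obtain N where N: "\<And>m n. m \<ge> N \<Longrightarrow> norm (\<Sum>i\<in>{m..<n}. (cmod (cinner x (e i)))\<^sup>2) < r\<^sup>2"
      using \<open>summable (\<lambda>i. (cmod (cinner x (e i)))\<^sup>2)\<close> unfolding summable_Cauchy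
      by (metis zero_less_power)
    show "\<exists>N. \<forall>m\<ge>N. \<forall>n. norm (\<Sum>i\<in>{m..<n}. ?t i) < r"
    proof (intro exI allI impI)
      fix m n assume "m \<ge> N"
      then have "(norm (\<Sum>i\<in>{m..<n}. ?t i))\<^sup>2 < r\<^sup>2"
        using pyth[of m n] N[of m n] by (simp add: sum_nonneg)
      then show "norm (\<Sum>i\<in>{m..<n}. ?t i) < r"
        using \<open>r > 0\<close> by (simp add: power_less_imp_less_base)
    qed
  qed
  then obtain y where y: "?t sums y" by (auto simp: summable_def)
  have "cinner (x - y) (e j) = 0" for j
  proof -
    have lim: "(\<lambda>n. x - (\<Sum>i<n. ?t i)) \<longlonglongrightarrow> x - y"
      using y by (intro tendsto_diff tendsto_const) (simp add: sums_def)
    have "(\<lambda>n. norm ((x - (\<Sum>i<n. ?t i)) - (x - y))) \<longlonglongrightarrow> 0"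
      by (rule tendsto_norm_zero[OF LIM_zero[OF lim]])
    moreover have "\<forall>\<^sub>F n in sequentially. cmod (cinner (x - y) (e j)) \<le> norm ((x - (\<Sum>i<n. ?t i)) - (x - y)) * 1"
    proof (rule eventually_sequentiallyI[of "Suc j"])
      fix n assume "Suc j \<le> n"
      then have "cinner (x - y) (e j) = - cinner ((x - (\<Sum>i<n. ?t i)) - (x - y)) (e j)"
        using onb_partial_sum_cinner[of j n x] by (simp add: cinner_diff_left)
      then have "cmod (cinner (x - y) (e j)) \<le> norm ((x - (\<Sum>i<n. ?t i)) - (x - y)) * norm (e j)"
        by (simp only: norm_minus_cancel cmod_cinner_le)
      also have "\<dots> \<le> norm ((x - (\<Sum>i<n. ?t i)) - (x - y)) * 1"
        by (intro mult_left_mono onb_seq_norm_le) simp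
      finally show "cmod (cinner (x - y) (e j)) \<le> norm ((x - (\<Sum>i<n. ?t i)) - (x - y)) * 1" .
    qed
    ultimately have "cmod (cinner (x - y) (e j)) \<le> 0"
      by (intro tendsto_le[OF sequentially_bot _ tendsto_const]) auto
    then show ?thesis by simp
  qed
  then have "x - y = 0" using e unfolding onb_seq_def by blast
  then show ?thesis using y by simp
qed

lemma parseval_norm: "((\<lambda>i. (cmod (cinner x (e i)))\<^sup>2) has_sum (norm x)\<^sup>2) UNIV"
proof (rule sums_nonneg_imp_has_sum)
  have "(\<lambda>n. (norm x)\<^sup>2 - (norm (x - (\<Sum>i<n. cinner x (e i) *\<^sub>C e i)))\<^sup>2) \<longlonglongrightarrow> (norm x)\<^sup>2 - (norm (x - x))\<^sup>2"
    using onb_expansion[of x] unfolding sums_def by (intro tendsto_intros)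
  then show "(\<lambda>i. (cmod (cinner x (e i)))\<^sup>2) sums (norm x)\<^sup>2"
    by (simp add: onb_partial_sum_norm sums_def)
qed simp

end

lemma cinner_sums_left:
  assumes "f sums x"
  shows "(\<lambda>n. cinner (f n) y) sums cinner x (y::'a::complex_inner_space)"
proof -
  have "bounded_linear (\<lambda>x. cinner x y)"
    by (rule bounded_linear_intro[of _ "norm y"])
      (auto simp: cinner_add_left cinner_scaleR_left scaleR_conv_of_real cmod_cinner_le)
  then show ?thesis using assms by (rule bounded_linear.sums)
qed

lemma prod_le_half_squares: "(a::real) * b \<le> (a\<^sup>2 + b\<^sup>2) / 2"
  using sum_squares_bound[of a b] by simp

lemma parseval:
  fixes e :: "nat \<Rightarrow> 'a::complex_hilbert_space"
  assumes e: "onb_seq e"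
  shows "((\<lambda>i. cinner x (e i) * cinner (e i) y) has_sum cinner x y) UNIV"
proof (rule norm_summable_imp_has_sum)
  show "(\<lambda>i. cinner x (e i) * cinner (e i) y) sums cinner x y"
    using cinner_sums_left[OF onb_expansion[OF e, of x], of y] by (simp add: cinner_scaleC_left)
  have s: "summable (\<lambda>i. (cmod (cinner x (e i)))\<^sup>2)" for x
    using parseval_norm[OF e, of x] has_sum_imp_sums sums_summable by blast
  show "summable (\<lambda>i. norm (cinner x (e i) * cinner (e i) y))"
  proof (rule summable_comparison_test'[of "\<lambda>i. ((cmod (cinner x (e i)))\<^sup>2 + (cmod (cinner y (e i)))\<^sup>2) / 2" 0])
    show "summable (\<lambda>i. ((cmod (cinner x (e i)))\<^sup>2 + (cmod (cinner y (e i)))\<^sup>2) / 2)"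
      by (intro summable_divide summable_add s)
    fix i
    have "cmod (cinner (e i) y) = cmod (cinner y (e i))" by (metis cinner_commute complex_mod_cnj)
    then show "norm (norm (cinner x (e i) * cinner (e i) y)) \<le> ((cmod (cinner x (e i)))\<^sup>2 + (cmod (cinner y (e i)))\<^sup>2) / 2"
      using prod_le_half_squares[of "cmod (cinner x (e i))" "cmod (cinner y (e i))"] by (simp add: norm_mult)
  qed
qed

section \<open>Cholesky expansion of positive operators and the trace\<close>

text \<open>One step of the Cholesky algorithm: the rank one part of \<open>f\<close> that accounts for its action on
  \<open>a\<close> is subtracted (a Schur complement). If \<open>\<langle>f a, a\<rangle> = 0\<close> then \<open>f a = 0\<close> by Cauchy--Schwarz, and the
  convention \<open>x / 0 = 0\<close> makes the step trivial.\<close>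

definition cholesky_step :: "('a::complex_inner_space \<Rightarrow> 'a) \<Rightarrow> 'a \<Rightarrow> 'a \<Rightarrow> 'a" where
  "cholesky_step f a x = f x - (cinner x (f a) / cinner (f a) a) *\<^sub>C f a"

primrec cholesky_residual :: "('a::complex_inner_space \<Rightarrow> 'a) \<Rightarrow> (nat \<Rightarrow> 'a) \<Rightarrow> nat \<Rightarrow> 'a \<Rightarrow> 'a" where
  "cholesky_residual f e 0 = f"
| "cholesky_residual f e (Suc n) = cholesky_step (cholesky_residual f e n) (e n)"

definition cholesky_vector :: "('a::complex_inner_space \<Rightarrow> 'a) \<Rightarrow> (nat \<Rightarrow> 'a) \<Rightarrow> nat \<Rightarrow> 'a" where
  "cholesky_vector f e n = (let r = cholesky_residual f e n (e n)
     in (1 / sqrt (Re (cinner r (e n)))) *\<^sub>R r)"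

lemma cholesky_step_form:
  assumes "positive_map f"
  shows "cinner (cholesky_step f a x) x =
    of_real (Re (cinner (f x) x) - (cmod (cinner (f a) x))\<^sup>2 / Re (cinner (f a) a))"
proof -
  have "cinner (cholesky_step f a x) x
      = cinner (f x) x - (cinner x (f a) * cinner (f a) x) / cinner (f a) a"
    by (simp add: cholesky_step_def cinner_diff_left cinner_scaleC_left)
  also have "cinner x (f a) * cinner (f a) x = of_real ((cmod (cinner (f a) x))\<^sup>2)"
    using cinner_mult_swap[of "f a" x] by (simp only: mult.commute)
  finally show ?thesis
    using positive_map_form_real[OF assms, of x] positive_map_form_real[OF assms, of a] 
    by (metis of_real_diff of_real_divide)
qed

lemma positive_map_cholesky_step:
  assumes "positive_map f"
  shows "positive_map (cholesky_step f a)"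
  unfolding positive_map_def
proof (intro conjI allI)
  note D = positive_mapD[OF assms]
  show "cholesky_step f a (x + y) = cholesky_step f a x + cholesky_step f a y" for x y
    by (simp add: cholesky_step_def D cinner_add_left add_divide_distrib scaleC_add_left)
  show "cholesky_step f a (c *\<^sub>C x) = c *\<^sub>C cholesky_step f a x" for c x
    by (simp add: cholesky_step_def D cinner_scaleC_left scaleC_diff_right scaleC_scaleC)
  show "cinner (cholesky_step f a x) x \<in> \<real>\<^sub>\<ge>\<^sub>0" for x
  proof -
    have "(cmod (cinner (f a) x))\<^sup>2 / Re (cinner (f a) a) \<le> Re (cinner (f x) x)"
    proof (cases "Re (cinner (f a) a) = 0")
      case False
      with D(6)[of a] have "Re (cinner (f a) a) > 0" by linarith
      then show ?thesis
        using positive_map_Cauchy_Schwarz[OF assms, of a x] by (simp add: field_simps)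
    qed (simp add: D)
    then show ?thesis
      unfolding cholesky_step_form[OF assms] nonneg_Reals_of_real_iff by simp
  qed
qed

lemma cholesky_step_le:
  assumes "positive_map f"
  shows "Re (cinner (cholesky_step f a x) x) \<le> Re (cinner (f x) x)"
  unfolding cholesky_step_form[OF assms] using positive_mapD(6)[OF assms, of a] by simp

lemma cholesky_step_self:
  assumes "positive_map f"
  shows "cholesky_step f a a = 0"
proof (cases "cinner (f a) a = 0")
  case True
  have "(cmod (cinner (f a) (f a)))\<^sup>2 \<le> 0"
    using positive_map_Cauchy_Schwarz[OF assms, of a "f a"] True by simp
  then have "f a = 0" by (simp add: cinner_self_norm)
  then show ?thesis by (simp add: cholesky_step_def)
next
  case False
  then show ?thesis
    using positive_map_symmetric[OF assms, of a a] by (simp add: cholesky_step_def)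
qed

lemma cholesky_step_kernel:
  assumes "positive_map f" "f y = 0"
  shows "cholesky_step f a y = 0"
proof -
  have "cinner y (f a) = 0" using positive_map_symmetric[OF assms(1), of y a] assms(2) by simp
  then show ?thesis by (simp add: cholesky_step_def assms(2))
qed

lemma positive_map_cholesky_residual:
  "positive_map f \<Longrightarrow> positive_map (cholesky_residual f e n)"
  by (induction n) (auto intro: positive_map_cholesky_step)

lemma cholesky_residual_le:
  assumes "positive_map f"
  shows "Re (cinner (cholesky_residual f e n x) x) \<le> Re (cinner (f x) x)"
proof (induction n)
  case (Suc n)
  then show ?case
    using cholesky_step_le[OF positive_map_cholesky_residual[OF assms, of e n], of "e n" x] by simp
qed simp

lemma cholesky_residual_kernel:
  assumes "positive_map f"
  shows "j < n \<Longrightarrow> cholesky_residual f e n (e j) = 0"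
proof (induction n)
  case (Suc n)
  note p = positive_map_cholesky_residual[OF assms, of e n]
  show ?case
    using Suc cholesky_step_self[OF p] cholesky_step_kernel[OF p] by (cases "j = n") auto
qed simp

lemma cholesky_residual_eq:
  assumes "positive_map f"
  shows "cholesky_residual f e n x =
    f x - (\<Sum>k<n. cinner x (cholesky_vector f e k) *\<^sub>C cholesky_vector f e k)"
proof (induction n)
  case (Suc n)
  define r c where "r = cholesky_residual f e n (e n)" and "c = Re (cinner r (e n))"
  note p = positive_map_cholesky_residual[OF assms, of e n]
  have c: "cinner r (e n) = of_real c" "0 \<le> c"
    using positive_map_form_real[OF p, of "e n"] positive_mapD(6)[OF p, of "e n"] by (auto simp: r_def c_def)
  have v: "cholesky_vector f e n = of_real (1 / sqrt c) *\<^sub>C r"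
    by (simp add: cholesky_vector_def Let_def r_def[symmetric] c_def[symmetric] scaleR_scaleC)
  have "cinner x (cholesky_vector f e n) *\<^sub>C cholesky_vector f e n
      = (of_real (1 / sqrt c * (1 / sqrt c)) * cinner x r) *\<^sub>C r"
    unfolding v cinner_scaleC_right scaleC_scaleC
    by (simp only: complex_cnj_complex_of_real of_real_mult ac_simps)
  also have "1 / sqrt c * (1 / sqrt c) = 1 / c" using c(2) by simp
  finally have "cinner x (cholesky_vector f e n) *\<^sub>C cholesky_vector f e n = (cinner x r / cinner r (e n)) *\<^sub>C r"
    by (simp add: c(1))
  then show ?case
    using Suc by (simp add: cholesky_step_def r_def)
qed simp

text \<open>After \<open>n\<close> steps the residual \<open>R n\<close> annihilates the first \<open>n\<close> basis vectors, and
  \<open>0 \<le> R n \<le> A\<close> bounds its norm by that of \<open>A\<close>. Hence \<open>R n x\<close> equals \<open>R n\<close> at the tail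
  of the basis expansion of \<open>x\<close>, and tends to \<open>0\<close>.\<close>

lemma cholesky_expansion:
  fixes A :: "'a::complex_hilbert_space \<Rightarrow>\<^sub>L 'a"
  assumes e: "onb_seq e" and A: "A \<in> pos_ops"
  defines "v \<equiv> cholesky_vector (blinfun_apply A) e"
  shows "(\<lambda>k. cinner x (v k) *\<^sub>C v k) sums blinfun_apply A x"
proof -
  have pA: "positive_map (blinfun_apply A)" using A by (simp add: pos_ops_iff)
  define R where "R n = cholesky_residual (blinfun_apply A) e n" for n
  have pR: "positive_map (R n)" for n
    unfolding R_def by (rule positive_map_cholesky_residual[OF pA])
  have norm_R: "norm (R n y) \<le> norm A * norm y" for n y
    by (rule positive_map_norm_le[OF pR])
      (auto simp: R_def intro: order_trans[OF cholesky_residual_le[OF pA] bounded_op_form_bound])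
  define s where "s n = (\<Sum>i<n. cinner x (e i) *\<^sub>C e i)" for n
  have Rk: "R n (e j) = 0" if "j < n" for j n
    unfolding R_def by (rule cholesky_residual_kernel[OF pA that])
  have Rs: "R n (\<Sum>i<m. cinner x (e i) *\<^sub>C e i) = 0" if "m \<le> n" for m n
    using that
    by (induction m) (auto simp: positive_mapD[OF pR] Rk)
  have "(\<lambda>n. norm A * norm (x - s n)) \<longlonglongrightarrow> norm A * norm (x - x)"
    using onb_expansion[OF e, of x] unfolding sums_def s_def by (intro tendsto_intros)
  then have "(\<lambda>n. norm A * norm (x - s n)) \<longlonglongrightarrow> 0" by simp
  moreover have "norm (R n x) \<le> norm A * norm (x - s n)" for n
    using norm_R[of n "x - s n"] Rs[of n n] by (simp add: positive_mapD[OF pR] s_def)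
  ultimately have "(\<lambda>n. norm (R n x)) \<longlonglongrightarrow> 0"
    by (intro tendsto_sandwich[of "\<lambda>_. 0" "\<lambda>n. norm (R n x)" _ "\<lambda>n. norm A * norm (x - s n)"]) auto
  then have "(\<lambda>n. R n x) \<longlonglongrightarrow> 0" by (rule tendsto_norm_zero_cancel)
  then have "(\<lambda>n. blinfun_apply A x - R n x) \<longlonglongrightarrow> blinfun_apply A x - 0"
    by (intro tendsto_diff tendsto_const)
  then show ?thesis
    by (simp add: sums_def R_def v_def cholesky_residual_eq[OF pA])
qed

lemma pair_summable_nonneg:
  fixes g :: "nat \<Rightarrow> nat \<Rightarrow> real"
  assumes "\<And>n k. 0 \<le> g n k" "\<And>n. (g n has_sum a n) UNIV" "a summable_on UNIV"
  shows "(\<lambda>(n, k). g n k) summable_on UNIV \<times> UNIV"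
proof -
  have "(\<lambda>p. norm (case p of (n, k) \<Rightarrow> g n k)) summable_on Sigma UNIV (\<lambda>_. UNIV)"
  proof (subst Infinite_Sum.abs_summable_on_Sigma_iff, intro conjI ballI)
    show "(\<lambda>k. norm (case (n, k) of (n, k) \<Rightarrow> g n k)) summable_on UNIV" for n
      using assms by (auto simp: summable_on_def)
    have "infsum (\<lambda>k. norm (case (n, k) of (n, k) \<Rightarrow> g n k)) UNIV = a n" for n
      using assms(1) infsumI[OF assms(2)] by simp
    moreover have "0 \<le> a n" for n using has_sum_nonneg[OF assms(2)] assms(1) by blast
    ultimately show "(\<lambda>n. norm (infsum (\<lambda>k. norm (case (n, k) of (n, k) \<Rightarrow> g n k)) UNIV)) summable_on UNIV"
      using assms(3) by simp
  qed
  then show ?thesis using assms(1) by (simp add: case_prod_unfold)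
qed

lemma has_sum_iterated_swap:
  fixes f :: "nat \<Rightarrow> nat \<Rightarrow> 'c::banach"
  assumes "(\<lambda>(n, k). norm (f n k)) summable_on UNIV \<times> UNIV"
    and a: "\<And>n. (f n has_sum a n) UNIV" and b: "\<And>k. ((\<lambda>n. f n k) has_sum b k) UNIV"
  obtains s where "(a has_sum s) UNIV" "(b has_sum s) UNIV"
proof -
  let ?F = "\<lambda>(n, k). f n k"
  have "(\<lambda>p. norm (?F p)) summable_on UNIV \<times> UNIV"
    using assms(1) by (simp add: case_prod_unfold)
  then obtain s where s: "(?F has_sum s) (UNIV \<times> UNIV)"
    using Infinite_Sum.abs_summable_summable unfolding summable_on_def by blast
  have "(a has_sum s) UNIV"
    by (rule has_sum_Sigma[OF isUCont_plus s]) (simp add: a)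
  moreover have "((?F \<circ> prod.swap) has_sum s) (UNIV \<times> UNIV)"
    using s has_sum_reindex[of prod.swap "UNIV \<times> UNIV" ?F s] by (simp add: product_swap)
  then have "(b has_sum s) UNIV"
    by (rule has_sum_Sigma[OF isUCont_plus]) (simp add: b)
  ultimately show thesis by (rule that)
qed

text \<open>Parseval's identity, summed over the Cholesky vectors, gives
  \<open>(\<Sum>k. \<parallel>v\<^sub>k\<parallel>\<^sup>2) = tr A < \<infinity>\<close>. This makes the double series
  \<open>\<langle>T v\<^sub>k, e\<^sub>n\<rangle> \<langle>e\<^sub>n, v\<^sub>k\<rangle>\<close> absolutely summable; summing first over \<open>k\<close> gives the diagonal entries of \<open>T A\<close>,
  summing first over \<open>n\<close> gives \<open>\<langle>T v\<^sub>k, v\<^sub>k\<rangle>\<close>.\<close>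

theorem trace_vector_expansion:
  fixes A :: "'a::complex_hilbert_space \<Rightarrow>\<^sub>L 'a"
  assumes sep: "separable_space (euclidean :: 'a topology)" and A: "A \<in> pos_trace_class"
  obtains v :: "nat \<Rightarrow> 'a" where
    "\<And>T. T \<in> bounded_ops \<Longrightarrow>
       (\<lambda>k. cinner (blinfun_apply T (v k)) (v k)) sums trace (T o\<^sub>L A)"
    "\<And>T. T \<in> bounded_ops \<Longrightarrow>
       ((\<lambda>b. cinner (blinfun_apply T (blinfun_apply A b)) b) has_sum trace (T o\<^sub>L A)) some_onb"
proof -
  obtain e :: "nat \<Rightarrow> 'a" where e: "onb_seq e"
    and tr: "\<And>(f :: 'a \<Rightarrow> complex) s. f 0 = 0 \<Longrightarrow> (f has_sum s) some_onb \<longleftrightarrow> ((\<lambda>n. f (e n)) has_sum s) UNIV"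
    by (rule obtain_onb_seq[OF sep]) (rule that)
  have A': "A \<in> pos_ops" and sA: "(\<lambda>b. cinner (blinfun_apply A b) b) summable_on some_onb"
    using A by (auto simp: pos_trace_class_iff)
  define v where "v = cholesky_vector (blinfun_apply A) e"
  have exp: "(\<lambda>k. cinner x (v k) *\<^sub>C v k) sums blinfun_apply A x" for x
    unfolding v_def by (rule cholesky_expansion[OF e A'])
  have e1: "norm (e n) \<le> 1" for n by (rule onb_seq_norm_le[OF e])
  have col: "((\<lambda>k. (cmod (cinner x (v k)))\<^sup>2) has_sum Re (cinner (blinfun_apply A x) x)) UNIV" for x
  proof (rule sums_nonneg_imp_has_sum)
    have "(\<lambda>k. cinner x (v k) * cinner (v k) x) sums cinner (blinfun_apply A x) x"
      using cinner_sums_left[OF exp, of x x] by (simp add: cinner_scaleC_left)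
    from sums_Re[OF this] show "(\<lambda>k. (cmod (cinner x (v k)))\<^sup>2) sums Re (cinner (blinfun_apply A x) x)"
      unfolding cinner_mult_swap Re_complex_of_real .
  qed simp
  have row: "((\<lambda>n. (cmod (cinner (e n) x))\<^sup>2) has_sum (norm x)\<^sup>2) UNIV" for x
    using parseval_norm[OF e, of x] by (metis (no_types, lifting) cinner_commute complex_mod_cnj has_sum_cong)
  have "(\<lambda>n. Re (cinner (blinfun_apply A (e n)) (e n))) summable_on UNIV"
  proof -
    obtain s where "((\<lambda>b. cinner (blinfun_apply A b) b) has_sum s) some_onb"
      using sA by (auto simp: summable_on_def)
    then have "((\<lambda>n. cinner (blinfun_apply A (e n)) (e n)) has_sum s) UNIV"
      by (subst (asm) tr) auto
    then show ?thesis using has_sum_Re has_sum_imp_summable by blast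
  qed
  then have "(\<lambda>(n, k). (cmod (cinner (e n) (v k)))\<^sup>2) summable_on UNIV \<times> UNIV"
    by (intro pair_summable_nonneg[where a="\<lambda>n. Re (cinner (blinfun_apply A (e n)) (e n))"] col) auto
  then have "(\<lambda>(n, k). norm ((cmod (cinner (e n) (v k)))\<^sup>2)) summable_on UNIV \<times> UNIV" by simp
  then obtain s where "((\<lambda>k. (norm (v k))\<^sup>2) has_sum s) UNIV"
    by (rule has_sum_iterated_swap[OF _ col row]) blast
  then have sv: "(\<lambda>k. (norm (v k))\<^sup>2) summable_on UNIV" and sv': "summable (\<lambda>k. (norm (v k))\<^sup>2)"
    by (auto simp: summable_on_def dest: has_sum_imp_sums sums_summable)
  have main: "\<exists>s. ((\<lambda>k. cinner (blinfun_apply T (v k)) (v k)) has_sum s) UNIV \<and>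
      ((\<lambda>n. cinner (blinfun_apply T (blinfun_apply A (e n))) (e n)) has_sum s) UNIV"
    if T: "T \<in> bounded_ops" for T
  proof -
    \<comment> \<open>Summability comes from \<open>a b \<le> (a\<^sup>2 + b\<^sup>2) / 2\<close> and Parseval for \<open>T v\<^sub>k\<close> and \<open>v\<^sub>k\<close>.\<close>
    define f where "f k n = cinner (blinfun_apply T (v k)) (e n) * cinner (e n) (v k)" for k n
    have Tv: "norm (blinfun_apply T (v k)) \<le> norm T * norm (v k)" for k by (rule norm_blinfun)
    have "(\<lambda>(k, n). norm (f k n)) summable_on UNIV \<times> UNIV"
    proof (rule pair_summable_nonneg[where a="\<lambda>k. infsum (\<lambda>n. norm (f k n)) UNIV"])
      have row2: "((\<lambda>n. ((cmod (cinner (e n) (blinfun_apply T (v k))))\<^sup>2 + (cmod (cinner (e n) (v k)))\<^sup>2) / 2)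
          has_sum ((norm (blinfun_apply T (v k)))\<^sup>2 + (norm (v k))\<^sup>2) / 2) UNIV" for k
        using has_sum_cmult_left[OF has_sum_add[OF row row], of "blinfun_apply T (v k)" "v k" "1/2"] by simp
      have le: "norm (f k n) \<le> ((cmod (cinner (e n) (blinfun_apply T (v k))))\<^sup>2 + (cmod (cinner (e n) (v k)))\<^sup>2) / 2" for k n
      proof -
        have "cmod (cinner (blinfun_apply T (v k)) (e n)) = cmod (cinner (e n) (blinfun_apply T (v k)))"
          by (metis cinner_commute complex_mod_cnj)
        then show ?thesis using prod_le_half_squares by (simp add: f_def norm_mult)
      qed
      have sf: "(\<lambda>n. norm (f k n)) summable_on UNIV" for k
        by (rule summable_on_comparison_test[OF has_sum_imp_summable[OF row2[of k]]]) (use le[of k] in simp_all)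
      then show "((\<lambda>n. norm (f k n)) has_sum infsum (\<lambda>n. norm (f k n)) UNIV) UNIV" for k
        by simp
      have "infsum (\<lambda>n. norm (f k n)) UNIV \<le> ((norm T)\<^sup>2 + 1) * (norm (v k))\<^sup>2" for k
      proof -
        have "infsum (\<lambda>n. norm (f k n)) UNIV \<le> ((norm (blinfun_apply T (v k)))\<^sup>2 + (norm (v k))\<^sup>2) / 2"
          by (rule has_sum_mono[OF has_sum_infsum[OF sf] row2 le])
        also have "\<dots> \<le> (norm (blinfun_apply T (v k)))\<^sup>2 + (norm (v k))\<^sup>2" by simp
        also have "\<dots> \<le> (norm T * norm (v k))\<^sup>2 + (norm (v k))\<^sup>2"
          using Tv by (intro add_right_mono power_mono) auto
        finally show ?thesis by (simp add: power_mult_distrib algebra_simps)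
      qed
      then show "(\<lambda>k. infsum (\<lambda>n. norm (f k n)) UNIV) summable_on UNIV"
        by (intro summable_on_comparison_test[OF summable_on_cmult_right[OF sv, of "(norm T)\<^sup>2 + 1"]])
          (auto intro: infsum_nonneg)
    qed auto
    moreover have "(f k has_sum cinner (blinfun_apply T (v k)) (v k)) UNIV" for k
      unfolding f_def by (rule parseval[OF e])
    moreover have "((\<lambda>k. f k n) has_sum cinner (blinfun_apply T (blinfun_apply A (e n))) (e n)) UNIV" for n
    proof (rule norm_summable_imp_has_sum)
      have "(\<lambda>k. blinfun_apply T (cinner (e n) (v k) *\<^sub>C v k)) sums blinfun_apply T (blinfun_apply A (e n))"
        by (rule bounded_linear.sums[OF blinfun.bounded_linear_right exp])
      from cinner_sums_left[OF this, of "e n"]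
      show "(\<lambda>k. f k n) sums cinner (blinfun_apply T (blinfun_apply A (e n))) (e n)"
        by (simp add: f_def bounded_opsD[OF T] cinner_scaleC_left mult.commute)
      show "summable (\<lambda>k. norm (f k n))"
      proof (rule summable_comparison_test'[OF summable_mult[OF sv', of "norm T"], of 0])
        fix k
        have "norm (f k n) \<le> (norm (blinfun_apply T (v k)) * norm (e n)) * (norm (e n) * norm (v k))"
          unfolding f_def norm_mult by (intro mult_mono cmod_cinner_le) auto
        also have "\<dots> \<le> ((norm T * norm (v k)) * 1) * (1 * norm (v k))"
          by (intro mult_mono Tv e1) auto
        finally show "norm (norm (f k n)) \<le> norm T * (norm (v k))\<^sup>2" by (simp add: power2_eq_square)
      qed
    qed
    ultimately show ?thesis by (rule has_sum_iterated_swap) blast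
  qed
  have main2: "(\<lambda>k. cinner (blinfun_apply T (v k)) (v k)) sums trace (T o\<^sub>L A)"
       "((\<lambda>b. cinner (blinfun_apply T (blinfun_apply A b)) b) has_sum trace (T o\<^sub>L A)) some_onb"
    if T: "T \<in> bounded_ops" for T
  proof -
    obtain s where s: "((\<lambda>k. cinner (blinfun_apply T (v k)) (v k)) has_sum s) UNIV"
      "((\<lambda>n. cinner (blinfun_apply T (blinfun_apply A (e n))) (e n)) has_sum s) UNIV"
      using main[OF T] by blast
    have 1: "((\<lambda>b. cinner (blinfun_apply T (blinfun_apply A b)) b) has_sum s) some_onb"
      using s(2) by (subst tr) auto
    then have "trace (T o\<^sub>L A) = s" by (simp add: trace_def infsumI)
    then show "(\<lambda>k. cinner (blinfun_apply T (v k)) (v k)) sums trace (T o\<^sub>L A)"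
       "((\<lambda>b. cinner (blinfun_apply T (blinfun_apply A b)) b) has_sum trace (T o\<^sub>L A)) some_onb"
      using 1 has_sum_imp_sums[OF s(1)] by auto
  qed
  show thesis by (rule that[of v]) (auto intro: main2)
qed

lemma trace_add_right:
  fixes A B :: "'a::complex_hilbert_space \<Rightarrow>\<^sub>L 'a"
  assumes sep: "separable_space (euclidean :: 'a topology)"
    and A: "A \<in> pos_trace_class" and B: "B \<in> pos_trace_class" and T: "T \<in> bounded_ops"
  shows "trace (T o\<^sub>L (A + B)) = trace (T o\<^sub>L A) + trace (T o\<^sub>L B)"
proof -
  have h: "((\<lambda>b. cinner (blinfun_apply T (blinfun_apply C b)) b) has_sum trace (T o\<^sub>L C)) some_onb"
    if "C \<in> pos_trace_class" for C
    using trace_vector_expansion[OF sep that] T by metis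
  have "((\<lambda>b. cinner (blinfun_apply T (blinfun_apply (A + B) b)) b) has_sum trace (T o\<^sub>L A) + trace (T o\<^sub>L B)) some_onb"
    using has_sum_add[OF h[OF A] h[OF B]] by (simp add: blinfun.add_left blinfun.add_right cinner_add_left)
  then show ?thesis using h[OF pos_trace_class_add[OF A B]] has_sum_unique by blast
qed

definition rank_one :: "'a::complex_hilbert_space \<Rightarrow> ('a \<Rightarrow>\<^sub>L 'a)" where
  "rank_one x = Blinfun (\<lambda>y. cinner y x *\<^sub>C x)"

lemma norm_scaleC: "norm (c *\<^sub>C (x::'a::complex_inner_space)) = cmod c * norm x"
proof -
  have "complex_of_real ((norm (c *\<^sub>C x))\<^sup>2) = (c * cnj c) * complex_of_real ((norm x)\<^sup>2)"
    unfolding cinner_self_norm[symmetric] by (simp add: cinner_linear_simps)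
  also have "\<dots> = of_real ((cmod c * norm x)\<^sup>2)"
    by (simp only: power_mult_distrib of_real_mult complex_norm_square)
  finally have "complex_of_real ((norm (c *\<^sub>C x))\<^sup>2) = of_real ((cmod c * norm x)\<^sup>2)" .
  then have "(norm (c *\<^sub>C x))\<^sup>2 = (cmod c * norm x)\<^sup>2" unfolding of_real_eq_iff .
  then show ?thesis by simp
qed

lemma rank_one_apply: "blinfun_apply (rank_one x) y = cinner y x *\<^sub>C x"
proof -
  have "bounded_linear (\<lambda>y. cinner y x *\<^sub>C x)"
  proof (rule bounded_linear_intro[of _ "norm x * norm x"])
    show "norm (cinner y x *\<^sub>C x) \<le> norm y * (norm x * norm x)" for y
      using mult_right_mono[OF cmod_cinner_le[of y x], of "norm x"] by (simp add: norm_scaleC mult.assoc)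
  qed (auto simp: cinner_add_left scaleC_add_left scaleR_scaleC cinner_scaleC_left scaleC_scaleC)
  then show ?thesis by (simp add: rank_one_def bounded_linear_Blinfun_apply)
qed

lemma rank_one_diagonal_has_sum:
  fixes x y :: "'a::complex_hilbert_space"
  assumes sep: "separable_space (euclidean :: 'a topology)"
  shows "((\<lambda>b. cinner y b * cinner b x) has_sum cinner y x) some_onb"
proof -
  obtain e :: "nat \<Rightarrow> 'a" where e: "onb_seq e"
    and tr: "\<And>(f :: 'a \<Rightarrow> complex) s. f 0 = 0 \<Longrightarrow> (f has_sum s) some_onb \<longleftrightarrow> ((\<lambda>n. f (e n)) has_sum s) UNIV"
    by (rule obtain_onb_seq[OF sep]) (rule that)
  show ?thesis by (subst tr) (auto simp: parseval[OF e])
qed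

lemma rank_one_pos_trace_class:
  fixes x :: "'a::complex_hilbert_space"
  assumes sep: "separable_space (euclidean :: 'a topology)"
  shows "rank_one x \<in> pos_trace_class"
proof -
  have "rank_one x \<in> pos_ops"
    by (auto simp: pos_ops_def bounded_ops_def rank_one_apply cinner_scaleC_left scaleC_scaleC
        cinner_mult_swap simp del: of_real_power)
  then show ?thesis
    using has_sum_imp_summable[OF rank_one_diagonal_has_sum[OF sep, of x x]]
    by (simp add: pos_trace_class_iff rank_one_apply cinner_scaleC_left mult.commute)
qed

lemma trace_rank_one:
  fixes x :: "'a::complex_hilbert_space"
  assumes sep: "separable_space (euclidean :: 'a topology)" and T: "T \<in> bounded_ops"
  shows "trace (T o\<^sub>L rank_one x) = cinner (blinfun_apply T x) x"
  using infsumI[OF rank_one_diagonal_has_sum[OF sep, of "blinfun_apply T x" x]]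
  by (simp add: trace_def rank_one_apply bounded_opsD[OF T] cinner_scaleC_left mult.commute)

section \<open>Existence of scalar spectral measures\<close>

definition trig :: "int \<Rightarrow> real \<Rightarrow> complex" where
  "trig k \<omega> = exp (\<i> * of_int k * of_real \<omega>)"

lemma trig_cis: "trig k \<omega> = cis (of_int k * \<omega>)"
  by (simp add: trig_def cis_conv_exp mult.assoc)

lemma trig_add: "trig (k + l) \<omega> = trig k \<omega> * trig l \<omega>"
  by (simp add: trig_def exp_add[symmetric] algebra_simps)

lemma trig_0 [simp]: "trig 0 \<omega> = 1"
  by (simp add: trig_def)

lemma cnj_trig: "cnj (trig k \<omega>) = trig (- k) \<omega>"
  by (simp add: trig_cis cis_cnj)

lemma norm_trig [simp]: "cmod (trig k \<omega>) = 1"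
  by (simp add: trig_cis)

lemma continuous_trig [continuous_intros]: "continuous_on S (trig k)"
  unfolding trig_def by (intro continuous_intros)

lemma measurable_trig [measurable]: "trig k \<in> borel_measurable borel"
  by (intro borel_measurable_continuous_onI continuous_trig)

definition circle_measure :: "real measure" where
  "circle_measure = uniform_measure lborel {- pi..pi}"

lemma circle_measure_density:
  "circle_measure = density lborel (\<lambda>x. ennreal (indicator {- pi..pi} x / (2 * pi)))"
  unfolding circle_measure_def uniform_measure_def
  by (intro arg_cong2[where f=density] refl ext)
    (auto simp: divide_ennreal[symmetric] ennreal_indicator ennreal_mult' split: split_indicator)

lemma sets_circle_measure [simp, measurable_cong]: "sets circle_measure = sets borel"
  by (simp add: circle_measure_def)

lemma space_circle_measure [simp]: "space circle_measure = UNIV"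
  by (simp add: circle_measure_def)

interpretation circle_measure: prob_space circle_measure
  unfolding circle_measure_def by (rule prob_space_uniform_measure) auto

lemma integrable_trig:
  assumes "finite_measure M" "trig k \<in> borel_measurable M"
  shows "integrable M (trig k)"
proof -
  interpret finite_measure M by fact
  show ?thesis by (rule integrable_const_bound[of _ 1]) (use assms in auto)
qed

lemma integrable_trig_circle [simp]: "integrable circle_measure (trig k)"
  by (rule integrable_trig) (auto intro: circle_measure.finite_measure)

lemma integral_trig_circle: "(\<integral>\<omega>. trig k \<omega> \<partial>circle_measure) = (if k = 0 then 1 else 0)"
proof (cases "k = 0")
  case True
  then show ?thesis using circle_measure.prob_space by simp
next
  case False
  define F where "F \<omega> = (1 / (2 * pi)) *\<^sub>R (trig k \<omega> / (\<i> * of_int k))" for \<omega>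
  have "(\<integral>\<omega>. trig k \<omega> \<partial>circle_measure) = (\<integral>\<omega>. (indicator {- pi..pi} \<omega> / (2 * pi)) *\<^sub>R trig k \<omega> \<partial>lborel)"
    unfolding circle_measure_density by (intro integral_density) auto
  also have "\<dots> = (\<integral>\<omega>. indicator {- pi..pi} \<omega> *\<^sub>R ((1 / (2 * pi)) *\<^sub>R trig k \<omega>) \<partial>lborel)"
    by (intro Bochner_Integration.integral_cong) auto
  also have "\<dots> = F pi - F (- pi)"
  proof (rule integral_FTC_atLeastAtMost)
    show "- pi \<le> pi" by simp
    show "continuous_on {- pi..pi} (\<lambda>\<omega>. (1 / (2 * pi)) *\<^sub>R trig k \<omega>)" by (intro continuous_intros)
    fix \<omega> 
    show "(F has_vector_derivative (1 / (2 * pi)) *\<^sub>R trig k \<omega>) (at \<omega> within {- pi..pi})"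
    proof -
      have "((\<lambda>z. exp (\<i> * of_int k * z) / (\<i> * of_int k)) has_field_derivative trig k \<omega>) (at (of_real \<omega>))"
        unfolding trig_def using False by (auto intro!: derivative_eq_intros)
      then have "((\<lambda>\<omega>. trig k \<omega> / (\<i> * of_int k)) has_vector_derivative trig k \<omega>) (at \<omega> within {- pi..pi})"
        unfolding trig_def by (rule has_vector_derivative_real_field)
      then show ?thesis
        unfolding F_def by (rule has_vector_derivative_scaleR[OF DERIV_const, simplified])
    qed
  qed
  also have "trig k pi = trig k (- pi)"
  proof -
    have "trig k pi = trig k (- pi) * exp (2 * of_real (of_int k) * of_real pi * \<i>)"
      unfolding trig_def exp_add[symmetric] by (simp add: algebra_simps)
    then show ?thesis using exp_integer_2pi[of "of_int k"] by simp
  qed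
  then have "F pi - F (- pi) = 0" by (simp add: F_def)
  finally show ?thesis using False by simp
qed

text \<open>\<open>N\<close> times the \<open>N\<close>-th Fejer mean of the series \<open>(\<Sum>k. \<gamma> k e\<^bsup>- i k \<theta>\<^esup>)\<close>. It is also the
  quadratic form of the kernel \<open>\<gamma> (a - b)\<close> at the vector \<open>(e\<^bsup>i a \<theta>\<^esup>)\<close>, which is why
  non-negative definiteness makes it non-negative.\<close>

definition fejer_sum :: "(int \<Rightarrow> complex) \<Rightarrow> nat \<Rightarrow> real \<Rightarrow> complex" where
  "fejer_sum \<gamma> N \<theta> = (\<Sum>a=1..N. \<Sum>b=1..N. \<gamma> (int a - int b) * trig (int b - int a) \<theta>)"

text \<open>The weight with which the Fejer sum contains the frequency \<open>h\<close>, equal to \<open>N - \<bar>h\<bar>\<close> for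
  \<open>\<bar>h\<bar> \<le> N\<close>.\<close>

definition fejer_count :: "nat \<Rightarrow> int \<Rightarrow> nat" where
  "fejer_count N h = card {(a, b) \<in> {1..N} \<times> {1..N}. int a - int b = h}"

lemma measurable_fejer_sum [measurable]: "fejer_sum \<gamma> N \<in> borel_measurable borel"
  unfolding fejer_sum_def by measurable

lemma trig_times_fejer_sum:
  "trig h \<theta> * fejer_sum \<gamma> N \<theta> =
    (\<Sum>a=1..N. \<Sum>b=1..N. \<gamma> (int a - int b) * trig (h + (int b - int a)) \<theta>)"
  unfolding fejer_sum_def sum_distrib_left trig_add[of h] by (simp only: ac_simps)

lemma integrable_trig_fejer_sum:
  "integrable circle_measure (\<lambda>\<theta>. trig h \<theta> * fejer_sum \<gamma> N \<theta>)"
  unfolding trig_times_fejer_sum by simp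

lemma fejer_sum_coefficient:
  "(\<integral>\<theta>. trig h \<theta> * fejer_sum \<gamma> N \<theta> \<partial>circle_measure) = of_nat (fejer_count N h) * \<gamma> h"
proof -
  have "(\<integral>\<theta>. trig h \<theta> * fejer_sum \<gamma> N \<theta> \<partial>circle_measure)
      = (\<integral>\<theta>. (\<Sum>a=1..N. \<Sum>b=1..N. \<gamma> (int a - int b) * trig (h + (int b - int a)) \<theta>) \<partial>circle_measure)"
    by (simp only: trig_times_fejer_sum)
  also have "\<dots> = (\<Sum>a=1..N. \<Sum>b=1..N. \<gamma> (int a - int b) * (if h + (int b - int a) = 0 then 1 else 0))"
    by (simp add: Bochner_Integration.integral_sum integral_trig_circle)
  also have "\<dots> = (\<Sum>p\<in>{(a, b) \<in> {1..N} \<times> {1..N}. int a - int b = h}. \<gamma> h)"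
    unfolding sum.cartesian_product by (intro sum.mono_neutral_cong_right) (auto split: if_splits)
  also have "\<dots> = of_nat (fejer_count N h) * \<gamma> h"
    by (simp add: fejer_count_def)
  finally show ?thesis .
qed

lemma fejer_count_le: "fejer_count N h \<le> N"
proof -
  have "fejer_count N h \<le> card ((\<lambda>b. (nat (int b + h), b)) ` {1..N})"
    unfolding fejer_count_def by (intro card_mono) (auto simp: image_iff)
  also have "\<dots> \<le> N" using card_image_le[of "{1..N}"] by (metis card_atLeastAtMost diff_Suc_1 finite_atLeastAtMost)
  finally show ?thesis .
qed

lemma fejer_count_ge: "N \<le> fejer_count N h + nat \<bar>h\<bar>"
proof -
  \<comment> \<open>For either sign of \<open>h\<close> one of the two shifts is \<open>0\<close> and the other is \<open>\<bar>h\<bar>\<close>.\<close>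
  let ?f = "\<lambda>c. (c + nat h, c + nat (- h))"
  have "N - nat \<bar>h\<bar> = card (?f ` {1..N - nat \<bar>h\<bar>})"
    by (subst card_image) (auto intro: inj_onI)
  also have "\<dots> \<le> fejer_count N h"
    unfolding fejer_count_def
    by (intro card_mono) (auto intro: finite_subset[of _ "{1..N} \<times> {1..N}"])
  finally show ?thesis by simp
qed

lemma fejer_count_asymp: "(\<lambda>N. real (fejer_count (Suc N) h) / real (Suc N)) \<longlonglongrightarrow> 1"
proof (rule tendsto_sandwich)
  show "\<forall>\<^sub>F N in sequentially. real (fejer_count (Suc N) h) / real (Suc N) \<le> 1"
    using fejer_count_le[of "Suc _" h] by (intro always_eventually allI) (simp add: divide_le_eq flip: of_nat_Suc)
  show "\<forall>\<^sub>F N in sequentially. 1 - real (nat \<bar>h\<bar>) * (1 / real (Suc N)) \<le> real (fejer_count (Suc N) h) / real (Suc N)"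
  proof (intro always_eventually allI)
    fix N
    have "real (Suc N) \<le> real (fejer_count (Suc N) h) + real (nat \<bar>h\<bar>)"
      using fejer_count_ge[of "Suc N" h] by (simp only: of_nat_add[symmetric] of_nat_le_iff)
    moreover have "1 - k * (1 / n) \<le> c / n" if "n \<le> c + k" "0 < n" for n c k :: real
      using that mult_right_mono[of n "c + k" n] by (simp add: field_simps)
    ultimately show "1 - real (nat \<bar>h\<bar>) * (1 / real (Suc N)) \<le> real (fejer_count (Suc N) h) / real (Suc N)"
      by (metis of_nat_0_less_iff zero_less_Suc)
  qed
  have "(\<lambda>N. 1 - real (nat \<bar>h\<bar>) * (1 / real (Suc N))) \<longlonglongrightarrow> 1 - real (nat \<bar>h\<bar>) * 0"
    by (intro tendsto_intros LIMSEQ_Suc[OF lim_1_over_n])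
  then show "(\<lambda>N. 1 - real (nat \<bar>h\<bar>) * (1 / real (Suc N))) \<longlonglongrightarrow> 1" by simp
qed auto

text \<open>The representative of \<open>\<omega>\<close> modulo \<open>2\<pi>\<close> in \<open>(-\<pi>, \<pi>]\<close>.\<close>

definition wrap :: "real \<Rightarrow> real" where
  "wrap \<omega> = \<omega> - 2 * pi * of_int \<lceil>(\<omega> - pi) / (2 * pi)\<rceil>"

lemma wrap_bounds: "- pi < wrap \<omega>" "wrap \<omega> \<le> pi"
proof -
  let ?c = "of_int \<lceil>(\<omega> - pi) / (2 * pi)\<rceil> :: real"
  have "?c - 1 < (\<omega> - pi) / (2 * pi)" "(\<omega> - pi) / (2 * pi) \<le> ?c" by linarith+
  then have "(?c - 1) * (2 * pi) < (\<omega> - pi) / (2 * pi) * (2 * pi)"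
    "(\<omega> - pi) / (2 * pi) * (2 * pi) \<le> ?c * (2 * pi)"
    by (simp_all only: mult_less_cancel_right_pos mult_le_cancel_right_pos pi_gt_zero zero_less_mult_iff zero_less_numeral simp_thms)
  then have "(?c - 1) * (2 * pi) < \<omega> - pi" "\<omega> - pi \<le> ?c * (2 * pi)" by simp_all
  then show "- pi < wrap \<omega>" "wrap \<omega> \<le> pi" by (simp_all add: wrap_def algebra_simps)
qed

lemma trig_wrap: "trig h (wrap \<omega>) = trig h \<omega>"
proof -
  let ?c = "\<lceil>(\<omega> - pi) / (2 * pi)\<rceil>"
  have "trig h (wrap \<omega>) = trig h \<omega> * exp (2 * of_int (- (h * ?c)) * of_real pi * \<i>)"
    unfolding trig_def wrap_def exp_add[symmetric] by (simp add: algebra_simps)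
  then show ?thesis using exp_integer_2pi[of "of_int (- (h * ?c))"] by simp
qed

lemma measurable_wrap: "wrap \<in> measurable borel borel_pi"
  unfolding borel_pi_def
proof (rule measurable_restrict_space2)
  show "wrap \<in> space borel \<rightarrow> {- pi..pi}" by (simp add: Pi_iff less_imp_le wrap_bounds)
  show "wrap \<in> borel_measurable borel" unfolding wrap_def by measurable
qed

lemma measurable_trig_borel_pi [measurable]: "trig k \<in> borel_measurable borel_pi"
  unfolding borel_pi_def by (intro measurable_restrict_space1) measurable

text \<open>Let \<open>c = \<gamma> 0\<close>. If \<open>c > 0\<close>, the Fejer sums divided by \<open>N c\<close> are probability densities for
  the normalised Lebesgue measure on \<open>[-\<pi>, \<pi>]\<close>, whose Fourier coefficients tend to \<open>\<gamma> h / c\<close>. By Helly's selection theorem a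
  subsequence converges weakly to a probability measure, which has the coefficients \<open>\<gamma> h / c\<close>. Its
  image under \<open>wrap\<close> has the same coefficients and no mass at \<open>-\<pi>\<close>.\<close>

theorem herglotz:
  assumes pos: "\<And>N \<theta>. fejer_sum \<gamma> N \<theta> \<in> \<real>\<^sub>\<ge>\<^sub>0"
  obtains \<mu> where "finite_measure \<mu>" "sets \<mu> = sets borel_pi" "emeasure \<mu> {- pi} = 0"
    "\<And>h. (\<integral>\<omega>. trig h \<omega> \<partial>\<mu>) = \<gamma> h"
proof -
  define c where "c = Re (\<gamma> 0)"
  have "\<gamma> 0 \<in> \<real>\<^sub>\<ge>\<^sub>0" using pos[of 1 0] by (simp add: fejer_sum_def)
  then have \<gamma>0: "\<gamma> 0 = of_real c" "0 \<le> c" by (auto simp: c_def complex_nonneg_Reals_iff complex_eq_iff)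
  define f where "f N \<theta> = Re (fejer_sum \<gamma> N \<theta>)" for N \<theta>
  have f: "fejer_sum \<gamma> N \<theta> = of_real (f N \<theta>)" "0 \<le> f N \<theta>" for N \<theta>
    using pos[of N \<theta>] by (auto simp: f_def complex_nonneg_Reals_iff complex_eq_iff)
  have [measurable]: "f N \<in> borel_measurable borel" for N unfolding f_def by measurable
  have count0: "fejer_count N 0 = N" for N
    using fejer_count_le[of N 0] fejer_count_ge[of N 0] by simp
  have int_f: "integrable circle_measure (f N)" for N
    using integrable_Re[OF integrable_trig_fejer_sum[of 0 \<gamma> N]] unfolding f_def[abs_def] by simp
  have "complex_of_real (\<integral>\<theta>. f N \<theta> \<partial>circle_measure) = of_real (real N * c)" for N
    using fejer_sum_coefficient[of 0 \<gamma> N] by (simp add: f count0 \<gamma>0)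
  then have total: "(\<integral>\<theta>. f N \<theta> \<partial>circle_measure) = real N * c" for N
    unfolding of_real_eq_iff .
  show thesis
  proof (cases "c = 0")
    case True
    \<comment> \<open>Every coefficient of the Fejer sum is bounded by the integral of the Fejer sum itself, \<open>N c = 0\<close>.\<close>
    have "\<gamma> h = 0" for h
    proof -
      define N where "N = Suc (nat \<bar>h\<bar>)"
      have "cmod (of_nat (fejer_count N h) * \<gamma> h) \<le> (\<integral>\<theta>. cmod (trig h \<theta> * fejer_sum \<gamma> N \<theta>) \<partial>circle_measure)"
        unfolding fejer_sum_coefficient[symmetric] by (rule integral_norm_bound)
      also have "\<dots> = 0" using total[of N] True f by (simp add: norm_mult)
      finally have "fejer_count N h = 0 \<or> \<gamma> h = 0" by simp
      moreover have "fejer_count N h > 0" using fejer_count_ge[of N h] by (simp add: N_def)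
      ultimately show ?thesis by simp
    qed
    then show thesis
      by (intro that[of "null_measure borel_pi"]) (auto intro!: finite_measureI)
  next
    case False
    with \<gamma>0 have c: "0 < c" by simp
    define g where "g N \<theta> = f (Suc N) \<theta> / (real (Suc N) * c)" for N \<theta>
    have g0: "0 \<le> g N \<theta>" for N \<theta> using f(2) c by (simp add: g_def)
    have [measurable]: "g N \<in> borel_measurable borel" for N unfolding g_def by measurable
    have int_g: "integrable circle_measure (g N)" for N
      unfolding g_def using int_f by simp
    have total_g: "(\<integral>\<theta>. g N \<theta> \<partial>circle_measure) = 1" for N
      unfolding g_def using total[of "Suc N"] c by simp
    define M where "M N = density circle_measure (\<lambda>\<theta>. ennreal (g N \<theta>))" for N
    have em: "emeasure (M N) UNIV = 1" for N
    proof -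
      have "emeasure (M N) UNIV = (\<integral>\<^sup>+\<theta>. ennreal (g N \<theta>) \<partial>circle_measure)"
        unfolding M_def by (subst emeasure_density) auto
      also have "\<dots> = ennreal 1"
        by (subst nn_integral_eq_integral[OF int_g]) (auto simp: g0 total_g)
      finally show ?thesis by simp
    qed
    have rd: "real_distribution (M N)" for N
    proof -
      have "prob_space (M N)" by (rule prob_spaceI) (use em in \<open>simp add: M_def\<close>)
      then show ?thesis by (auto simp: real_distribution_def real_distribution_axioms_def M_def)
    qed
    have char_M: "char (M N) (of_int h) = (real (fejer_count (Suc N) h) / real (Suc N)) * (\<gamma> h / c)" for N h
    proof -
      have "char (M N) (of_int h) = (\<integral>\<theta>. trig h \<theta> \<partial>M N)"
        by (simp add: char_def trig_def mult.assoc)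
      also have "\<dots> = (\<integral>\<theta>. g N \<theta> *\<^sub>R trig h \<theta> \<partial>circle_measure)"
        unfolding M_def by (intro integral_density) (auto simp: g0)
      also have "\<dots> = (\<integral>\<theta>. (1 / (real (Suc N) * c)) *\<^sub>R (trig h \<theta> * fejer_sum \<gamma> (Suc N) \<theta>) \<partial>circle_measure)"
        by (intro Bochner_Integration.integral_cong) (auto simp: g_def f scaleR_conv_of_real)
      also have "\<dots> = (1 / (real (Suc N) * c)) *\<^sub>R (of_nat (fejer_count (Suc N) h) * \<gamma> h)"
        unfolding integral_scaleR_right fejer_sum_coefficient ..
      finally show ?thesis by (simp add: scaleR_conv_of_real)
    qed
    have "tight M"
      unfolding tight_def
    proof (intro conjI allI impI rd)
      fix \<epsilon> :: real assume "\<epsilon> > 0"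
      have "measure (M N) {- 4<..4} = 1" for N
      proof -
        interpret real_distribution "M N" by (rule rd)
        have ae: "AE x in circle_measure. x \<in> {- 4<..4}"
          unfolding circle_measure_def
          by (rule AE_uniform_measureI) (use pi_less_4 in auto)
        have "AE x in M N. x \<in> {- 4<..4}"
          unfolding M_def using ae by (subst AE_density) auto
        then show ?thesis by (subst prob_eq_1) auto
      qed
      then show "\<exists>a b. a < b \<and> (\<forall>N. 1 - \<epsilon> < measure (M N) {a<..b})"
        using \<open>\<epsilon> > 0\<close> by (intro exI[of _ "-4"] exI[of _ 4]) simp
    qed
    then obtain r M' where r: "strict_mono r" and M': "real_distribution M'"
      and weak: "weak_conv_m (M \<circ> id \<circ> r) M'"
      using tight_imp_convergent_subsubsequence[of M id] strict_mono_id by (auto simp: strict_mono_def)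
    interpret M': real_distribution M' by (rule M')
    have char_M': "(\<integral>\<omega>. trig h \<omega> \<partial>M') = \<gamma> h / c" for h
    proof -
      have "(\<lambda>n. char ((M \<circ> id \<circ> r) n) (of_int h)) \<longlonglongrightarrow> char M' (of_int h)"
        by (rule levy_continuity1[OF _ M' weak]) (simp add: rd)
      moreover have "(\<lambda>N. char (M N) (of_int h)) \<longlonglongrightarrow> of_real 1 * (\<gamma> h / c)"
        unfolding char_M of_real_divide[symmetric] by (intro tendsto_intros fejer_count_asymp)
      then have "(\<lambda>n. char ((M \<circ> id \<circ> r) n) (of_int h)) \<longlonglongrightarrow> of_real 1 * (\<gamma> h / c)"
        using LIMSEQ_subseq_LIMSEQ[OF _ r] by (simp add: comp_def)
      ultimately have "char M' (of_int h) = \<gamma> h / c" using LIMSEQ_unique by fastforce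
      then show ?thesis by (simp add: char_def trig_def mult.assoc)
    qed
    have wM: "wrap \<in> measurable M' borel_pi" using measurable_wrap by simp
    define \<mu> where "\<mu> = density (distr M' borel_pi wrap) (\<lambda>_. ennreal c)"
    show thesis
    proof (rule that)
      show "finite_measure \<mu>"
        by (rule finite_measureI)
          (simp add: \<mu>_def emeasure_density_const emeasure_distr[OF wM] ennreal_mult_eq_top_iff
            M'.emeasure_eq_measure)
      show "sets \<mu> = sets borel_pi" by (simp add: \<mu>_def)
      have "{- pi} \<in> sets borel_pi" by (auto simp: borel_pi_def sets_restrict_space_iff)
      moreover have "wrap \<omega> \<noteq> - pi" for \<omega> using wrap_bounds(1)[of \<omega>] by linarith
      then have "wrap -` {- pi} = {}" by (simp add: vimage_def)
      ultimately show "emeasure \<mu> {- pi} = 0"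
        by (simp add: \<mu>_def emeasure_density_const emeasure_distr[OF wM])
      fix h
      have "(\<integral>\<omega>. trig h \<omega> \<partial>\<mu>) = (\<integral>\<omega>. c *\<^sub>R trig h \<omega> \<partial>distr M' borel_pi wrap)"
        unfolding \<mu>_def by (intro integral_density) (auto simp: c less_imp_le)
      also have "\<dots> = c *\<^sub>R (\<integral>\<omega>. trig h \<omega> \<partial>M')"
        by (simp add: integral_distr[OF wM] trig_wrap)
      finally show "(\<integral>\<omega>. trig h \<omega> \<partial>\<mu>) = \<gamma> h"
        using c by (simp add: char_M' scaleR_conv_of_real)
    qed
  qed
qed

section \<open>Uniqueness of scalar spectral measures\<close>

text \<open>As functions on the circle these form an algebra that contains the coordinate functions. This is
  all that the Stone--Weierstrass theorem, in its version for polynomials in the real and imaginary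
  part, has to know about them.\<close>

inductive trig_poly :: "(real \<Rightarrow> complex) \<Rightarrow> bool" where
  monomial: "trig_poly (\<lambda>\<omega>. c * trig k \<omega>)"
| add: "trig_poly f \<Longrightarrow> trig_poly g \<Longrightarrow> trig_poly (\<lambda>\<omega>. f \<omega> + g \<omega>)"

lemma trig_poly_mult:
  assumes "trig_poly f" "trig_poly g"
  shows "trig_poly (\<lambda>\<omega>. f \<omega> * g \<omega>)"
  using assms(1)
proof induction
  case (monomial c k)
  show ?case using assms(2)
  proof induction
    case (monomial d l)
    have "(\<lambda>\<omega>. c * trig k \<omega> * (d * trig l \<omega>)) = (\<lambda>\<omega>. (c * d) * trig (k + l) \<omega>)"
      by (simp add: trig_add mult_ac)
    then show ?case by (simp only: trig_poly.monomial)
  next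
    case (add g1 g2)
    then show ?case unfolding distrib_left by (intro trig_poly.add)
  qed
next
  case (add f1 f2)
  then show ?case unfolding distrib_right by (intro trig_poly.add)
qed

lemma trig_poly_const: "trig_poly (\<lambda>_. c)"
  using trig_poly.monomial[of c 0] by simp

lemma trig_poly_real_polynomial:
  "real_polynomial_function p \<Longrightarrow> trig_poly (\<lambda>\<omega>. of_real (p (cis \<omega>)))"
proof (induction rule: real_polynomial_function.induct)
  case (linear f)
  interpret bounded_linear f by fact
  have "trig 1 \<omega> = cis \<omega>" "trig (- 1) \<omega> = cnj (cis \<omega>)" for \<omega> by (simp_all add: trig_cis cis_cnj)
  then have cs: "complex_of_real (cos \<omega>) = (1/2) * trig 1 \<omega> + (1/2) * trig (- 1) \<omega>"
    "complex_of_real (sin \<omega>) = (- \<i> / 2) * trig 1 \<omega> + (\<i> / 2) * trig (- 1) \<omega>" for \<omega>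
    by (simp_all add: complex_eq_iff)
  have "f (cis \<omega>) = cos \<omega> * f 1 + sin \<omega> * f \<i>" for \<omega>
  proof -
    have "cis \<omega> = cos \<omega> *\<^sub>R 1 + sin \<omega> *\<^sub>R \<i>" by (simp add: complex_eq_iff)
    then show ?thesis by (simp add: add scaleR)
  qed
  then have "(\<lambda>\<omega>. complex_of_real (f (cis \<omega>))) =
      (\<lambda>\<omega>. ((1/2) * trig 1 \<omega> + (1/2) * trig (- 1) \<omega>) * of_real (f 1)
        + ((- \<i> / 2) * trig 1 \<omega> + (\<i> / 2) * trig (- 1) \<omega>) * of_real (f \<i>))"
    by (simp only: cs[symmetric] of_real_add of_real_mult)
  then show ?case
    by (simp only:) (intro trig_poly.add trig_poly_mult trig_poly.monomial trig_poly_const)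
qed (auto intro: trig_poly_const trig_poly.add trig_poly_mult)

text \<open>Three measures instead of two, since the dependence of a spectral measure on the operator \<open>A\<close> has
  to be shown additive; uniqueness is the case where \<open>L\<close> is the null measure.\<close>

locale additive_fourier = M: finite_measure M + N: finite_measure N + L: finite_measure L
  for M N L :: "real measure" +
  assumes sets_M: "sets M = sets borel_pi" and sets_N: "sets N = sets borel_pi"
    and sets_L: "sets L = sets borel_pi"
    and fourier_add: "\<And>h. (\<integral>\<omega>. trig h \<omega> \<partial>M) = (\<integral>\<omega>. trig h \<omega> \<partial>N) + (\<integral>\<omega>. trig h \<omega> \<partial>L)"
begin

lemma finite_borel_pi_measures:
  "P \<in> {M, N, L} \<Longrightarrow> finite_measure P \<and> sets P = sets borel_pi"
  using sets_M sets_N sets_L M.finite_measure_axioms N.finite_measure_axioms L.finite_measure_axioms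
  by auto

lemma measurable_borel_component:
  "P \<in> {M, N, L} \<Longrightarrow> f \<in> borel_measurable borel \<Longrightarrow> f \<in> borel_measurable P"
  using finite_borel_pi_measures[of P] measurable_cong_sets[of P borel_pi borel borel]
    measurable_restrict_space1[of f borel borel "{- pi..pi}"]
  unfolding borel_pi_def by blast

lemma integral_trig_poly_add:
  assumes "trig_poly f"
  shows "P \<in> {M, N, L} \<Longrightarrow> integrable P f"
    and "(\<integral>\<omega>. f \<omega> \<partial>M) = (\<integral>\<omega>. f \<omega> \<partial>N) + (\<integral>\<omega>. f \<omega> \<partial>L)"
proof -
  have "(\<forall>P\<in>{M, N, L}. integrable P f) \<and> (\<integral>\<omega>. f \<omega> \<partial>M) = (\<integral>\<omega>. f \<omega> \<partial>N) + (\<integral>\<omega>. f \<omega> \<partial>L)"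
    using assms
  proof induction
    case (monomial c k)
    have "integrable P (trig k)" if "P \<in> {M, N, L}" for P
      using finite_borel_pi_measures[OF that] measurable_borel_component[OF that measurable_trig]
      by (intro integrable_trig) auto
    then show ?case using fourier_add[of k] by (simp add: distrib_left)
  qed auto
  then show "P \<in> {M, N, L} \<Longrightarrow> integrable P f"
    "(\<integral>\<omega>. f \<omega> \<partial>M) = (\<integral>\<omega>. f \<omega> \<partial>N) + (\<integral>\<omega>. f \<omega> \<partial>L)" by auto
qed

text \<open>By the Stone--Weierstrass theorem \<open>g\<close> is a uniform limit of polynomials on the unit circle, and
  their restrictions are trigonometric polynomials.\<close>

lemma integral_continuous_add:
  fixes g :: "complex \<Rightarrow> real"
  assumes g: "continuous_on UNIV g"
  shows "(\<integral>\<omega>. g (cis \<omega>) \<partial>M) = (\<integral>\<omega>. g (cis \<omega>) \<partial>N) + (\<integral>\<omega>. g (cis \<omega>) \<partial>L)"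
proof -
  define I where "I P f = (\<integral>\<omega>. f (cis \<omega>) \<partial>P)" for P and f :: "complex \<Rightarrow> real"
  let ?d = "\<bar>I M g - (I N g + I L g)\<bar>"
  let ?m = "measure M (space M) + measure N (space N) + measure L (space L)"
  have gc: "continuous_on UNIV (\<lambda>\<omega>. g (cis \<omega>))"
    by (rule continuous_on_compose2[OF g]) (auto intro!: continuous_intros)
  have "compact (g ` sphere 0 1)"
    by (intro compact_continuous_image continuous_on_subset[OF g]) auto
  then obtain B where B: "\<And>z. z \<in> sphere 0 1 \<Longrightarrow> norm (g z) \<le> B"
    by (metis bounded_iff compact_imp_bounded imageI)
  have int: "integrable P (\<lambda>\<omega>. g (cis \<omega>))" if P: "P \<in> {M, N, L}" for P
  proof -
    interpret P: finite_measure P using finite_borel_pi_measures[OF P] by simp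
    have "norm (g (cis \<omega>)) \<le> B" for \<omega> by (rule B) simp
    then show ?thesis
      by (intro P.integrable_const_bound[of _ B] AE_I2 measurable_borel_component[OF P]
          borel_measurable_continuous_onI gc)
  qed
  have step: "?d \<le> \<epsilon> * ?m" if "\<epsilon> > 0" for \<epsilon>
  proof -
    obtain p where p: "real_polynomial_function p" "\<And>z. z \<in> sphere 0 1 \<Longrightarrow> \<bar>g z - p z\<bar> < \<epsilon>"
      using Stone_Weierstrass_real_polynomial_function[of "sphere 0 1" g \<epsilon>] g \<open>\<epsilon> > 0\<close>
      by (metis compact_sphere continuous_on_subset subset_UNIV)
    note tp = integral_trig_poly_add[OF trig_poly_real_polynomial[OF p(1)]]
    have ip: "integrable P (\<lambda>\<omega>. p (cis \<omega>))" if "P \<in> {M, N, L}" for P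
      using integrable_Re[OF tp(1)[OF that]] by simp
    have ep: "I M p = I N p + I L p"
      using tp(2) by (simp add: I_def flip: of_real_add)
    have close: "\<bar>I P g - I P p\<bar> \<le> \<epsilon> * measure P (space P)" if P: "P \<in> {M, N, L}" for P
    proof -
      interpret P: finite_measure P using finite_borel_pi_measures[OF P] by simp
      have "\<bar>I P g - I P p\<bar> = \<bar>\<integral>\<omega>. g (cis \<omega>) - p (cis \<omega>) \<partial>P\<bar>"
        unfolding I_def using int[OF P] ip[OF P] by (simp add: Bochner_Integration.integral_diff)
      also have "\<dots> \<le> (\<integral>\<omega>. \<bar>g (cis \<omega>) - p (cis \<omega>)\<bar> \<partial>P)" by (rule integral_abs_bound)
      also have "\<dots> \<le> (\<integral>\<omega>. \<epsilon> \<partial>P)"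
        using int[OF P] ip[OF P] p(2)
        by (intro integral_mono integrable_abs Bochner_Integration.integrable_diff) (auto intro: less_imp_le)
      finally show ?thesis by (simp add: mult.commute)
    qed
    have "?d = \<bar>(I M g - I M p) - (I N g - I N p) - (I L g - I L p)\<bar>"
      unfolding ep by simp
    also have "\<dots> \<le> \<bar>I M g - I M p\<bar> + \<bar>I N g - I N p\<bar> + \<bar>I L g - I L p\<bar>" by linarith
    also have "\<dots> \<le> \<epsilon> * ?m"
      using close[of M] close[of N] close[of L] by (simp add: distrib_left)
    finally show ?thesis .
  qed
  have m0: "?m + 1 > 0" by (simp add: add_nonneg_pos)
  have "?d * (1 / (?m + 1)) \<le> \<epsilon>" if "\<epsilon> > 0" for \<epsilon>
  proof -
    have "?d \<le> \<epsilon> * ?m" by (rule step[OF that])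
    also have "\<dots> \<le> \<epsilon> * (?m + 1)" using that by simp
    finally show ?thesis using m0 by (simp add: divide_le_eq)
  qed
  then have "?d * (1 / (?m + 1)) \<le> 0"
    by (rule field_le_epsilon[of _ 0, simplified])
  with m0 have "?d = 0" by (auto simp: divide_le_0_iff)
  then show ?thesis by (simp add: I_def)
qed

text \<open>The indicator of a closed set is the limit of the continuous functions \<open>max 0 (1 - n d(z, C))\<close>.\<close>

lemma emeasure_closed_add:
  fixes C :: "complex set"
  assumes C: "closed C"
  shows "emeasure M (cis -` C \<inter> space M) =
    emeasure N (cis -` C \<inter> space N) + emeasure L (cis -` C \<inter> space L)"
proof (cases "C = {}")
  case False
  define g where "g n z = max 0 (1 - real n * infdist z C)" for n z
  have g: "continuous_on UNIV (g n)" for n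
    unfolding g_def by (intro continuous_intros)
  have lim: "(\<lambda>n. g n z) \<longlonglongrightarrow> indicator C z" for z
  proof (cases "z \<in> C")
    case True
    then show ?thesis by (simp add: g_def)
  next
    case False
    then have pos: "infdist z C > 0"
      using infdist_pos_not_in_closed[OF C \<open>C \<noteq> {}\<close>] by simp
    obtain n0 where "1 / infdist z C < real n0" using reals_Archimedean2 by blast
    then have "\<forall>\<^sub>F n in sequentially. g n z = 0"
    proof (intro eventually_sequentiallyI[of n0])
      fix n assume "1 / infdist z C < real n0" "n0 \<le> n"
      then have "1 / infdist z C < real n" by linarith
      then have "1 < real n * infdist z C" using pos by (simp add: field_simps)
      then show "g n z = 0" by (simp add: g_def)
    qed
    then show ?thesis using False by (simp add: tendsto_eventually)
  qed
  have meas: "(\<lambda>\<omega>. g n (cis \<omega>)) \<in> borel_measurable borel" for n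
    by (intro borel_measurable_continuous_onI continuous_on_compose2[OF g]) (auto intro!: continuous_intros)
  have meas_ind: "(\<lambda>\<omega>. indicator C (cis \<omega>) :: real) \<in> borel_measurable borel"
    by (rule borel_measurable_LIMSEQ_real[OF lim meas])
  have bnd: "\<bar>g n z\<bar> \<le> 1" for n z by (simp add: g_def infdist_nonneg)
  have int_lim: "(\<lambda>n. \<integral>\<omega>. g n (cis \<omega>) \<partial>P) \<longlonglongrightarrow> measure P (cis -` C \<inter> space P)"
    if P: "P \<in> {M, N, L}" for P
  proof -
    interpret P: finite_measure P using finite_borel_pi_measures[OF P] by simp
    have "(\<lambda>n. \<integral>\<omega>. g n (cis \<omega>) \<partial>P) \<longlonglongrightarrow> (\<integral>\<omega>. indicator C (cis \<omega>) \<partial>P)"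
      by (rule integral_dominated_convergence[where w="\<lambda>_. 1"])
        (auto intro: measurable_borel_component[OF P] meas meas_ind lim intro!: AE_I2 bnd)
    also have "(\<integral>\<omega>. indicator C (cis \<omega>) \<partial>P) = (\<integral>\<omega>. indicator (cis -` C) \<omega> \<partial>P :: real)"
      by (intro Bochner_Integration.integral_cong) (auto simp: indicator_def)
    finally show ?thesis by simp
  qed
  have "(\<lambda>n. \<integral>\<omega>. g n (cis \<omega>) \<partial>M) \<longlonglongrightarrow>
      measure N (cis -` C \<inter> space N) + measure L (cis -` C \<inter> space L)"
    unfolding integral_continuous_add[OF g] by (intro tendsto_add int_lim) auto
  then have "measure M (cis -` C \<inter> space M) =
      measure N (cis -` C \<inter> space N) + measure L (cis -` C \<inter> space L)"
    using int_lim[of M] LIMSEQ_unique by blast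
  then show ?thesis
    by (simp add: M.emeasure_eq_measure N.emeasure_eq_measure L.emeasure_eq_measure)
qed simp

text \<open>The closed sets are an intersection-stable generator of the Borel sets.\<close>

lemma emeasure_cis_vimage_add:
  assumes "S \<in> sets borel"
  shows "emeasure M (cis -` S \<inter> space M) =
    emeasure N (cis -` S \<inter> space N) + emeasure L (cis -` S \<inter> space L)"
proof -
  define D where "D P = distr P borel cis" for P
  have cis: "cis \<in> borel_measurable borel"
    by (intro borel_measurable_continuous_onI continuous_intros)
  have D: "emeasure (D P) X = emeasure P (cis -` X \<inter> space P)" if "P \<in> {M, N, L}" "X \<in> sets borel" for P X
    unfolding D_def by (rule emeasure_distr[OF measurable_borel_component[OF that(1) cis] that(2)])
  have fin: "emeasure (D P) X \<noteq> \<infinity>" if "P \<in> {M, N, L}" "X \<in> sets borel" for P X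
    using D[OF that] finite_borel_pi_measures[OF that(1)] by (simp add: finite_measure.emeasure_finite)
  have closed: "emeasure (D M) C = emeasure (D N) C + emeasure (D L) C" if "closed C" for C
    using emeasure_closed_add[OF that] that by (simp add: D borel_closed)
  have "Int_stable (Collect (closed :: complex set \<Rightarrow> bool))" by (auto simp: Int_stable_def)
  moreover have "Collect closed \<subseteq> Pow (UNIV :: complex set)" by simp
  moreover have "S \<in> sigma_sets UNIV (Collect closed)" using assms by (simp add: borel_eq_closed)
  ultimately have "emeasure (D M) S = emeasure (D N) S + emeasure (D L) S"
  proof (induction rule: sigma_sets_induct_disjoint)
    case (compl A)
    then have A: "A \<in> sets borel" by (simp add: borel_eq_closed)
    have c: "emeasure (D P) (UNIV - A) = emeasure (D P) UNIV - emeasure (D P) A" if "P \<in> {M, N, L}" for P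
      using emeasure_compl[of A "D P"] fin[OF that A] A by (simp add: D_def)
    have "a + b - (c + d) = a - c + (b - d)"
      if "c \<le> a" "d \<le> b" "a \<noteq> \<infinity>" "b \<noteq> \<infinity>" "c \<noteq> \<infinity>" "d \<noteq> \<infinity>" for a b c d :: ennreal
      using that by (cases a; cases b; cases c; cases d)
        (auto simp: ennreal_minus ennreal_plus[symmetric] ennreal_le_iff simp del: ennreal_plus)
    moreover have "emeasure (D P) A \<le> emeasure (D P) UNIV" for P
      by (intro emeasure_mono) (auto simp: D_def)
    ultimately show ?case
      using compl closed[of UNIV] fin A by (simp add: c)
  next
    case (union A)
    then have A: "range A \<subseteq> sets borel" by (auto simp: borel_eq_closed)
    have u: "emeasure (D P) (\<Union>i. A i) = (\<Sum>i. emeasure (D P) (A i))" for P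
      using suminf_emeasure[of A "D P"] A union by (simp add: D_def)
    show ?case unfolding u using union by (simp add: suminf_add summableI)
  qed (auto simp: closed)
  then show ?thesis using assms by (simp add: D)
qed

text \<open>The map \<open>cis\<close> identifies the points \<open>-\<pi>\<close> and \<open>\<pi>\<close> and is otherwise injective on \<open>[-\<pi>, \<pi>]\<close>.
  Without mass at \<open>-\<pi>\<close>, the measures are therefore recovered from their images on the circle.\<close>

theorem emeasure_add:
  assumes null: "emeasure M {- pi} = 0" "emeasure N {- pi} = 0" "emeasure L {- pi} = 0"
    and E: "E \<in> sets borel_pi"
  shows "emeasure M E = emeasure N E + emeasure L E"
proof -
  \<comment> \<open>The argument function, set to \<open>\<pi>\<close> on the whole non-positive axis, so that it is
    measurable as a continuous function off a closed set.\<close>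
  define arg where "arg z = (if z \<in> \<real>\<^sub>\<le>\<^sub>0 then pi else Arg z)" for z
  have arg: "arg \<in> borel_measurable borel"
    unfolding arg_def
    by (intro borel_measurable_continuous_on_if borel_closed closed_nonpos_Reals_complex
        continuous_on_const continuous_on_Arg)
  have arg_cis: "arg (cis \<omega>) = \<omega>" if "\<omega> \<in> {- pi..pi}" "\<omega> \<noteq> - pi" for \<omega>
  proof -
    have A: "Arg (cis \<omega>) = \<omega>" using that by (intro Arg_cis) auto
    show ?thesis
    proof (cases "cis \<omega> \<in> \<real>\<^sub>\<le>\<^sub>0")
      case True
      then have "Arg (cis \<omega>) = pi"
        by (metis Arg_eq_pi cis_neq_zero complex_nonpos_Reals_iff complex_eq_iff less_eq_real_def zero_complex.simps)
      then show ?thesis using A True by (simp add: arg_def)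
    qed (simp add: arg_def A)
  qed
  have cis: "cis \<in> borel_measurable borel"
    by (intro borel_measurable_continuous_onI continuous_intros)
  define S where "S = arg -` E"
  have S: "S \<in> sets borel"
    using measurable_sets[OF arg, of E] E by (auto simp: S_def borel_pi_def sets_restrict_space_iff)
  have recover: "emeasure P E = emeasure P (cis -` S \<inter> space P)"
    if P: "P \<in> {M, N, L}" and P0: "emeasure P {- pi} = 0" for P
  proof (rule emeasure_eq_AE)
    have sP: "sets P = sets borel_pi" using finite_borel_pi_measures[OF P] by simp
    then have sp: "space P = {- pi..pi}"
      using sets_eq_imp_space_eq[OF sP] by (simp add: borel_pi_def space_restrict_space)
    have "{- pi} \<in> sets P" by (auto simp: sP borel_pi_def sets_restrict_space_iff)
    then have "AE \<omega> in P. \<omega> \<noteq> - pi" using P0 by (intro AE_I[of _ _ "{- pi}"]) auto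
    then show "AE \<omega> in P. (\<omega> \<in> E) = (\<omega> \<in> cis -` S \<inter> space P)"
      by (rule AE_mp) (auto intro!: AE_I2 simp: S_def sp arg_cis)
    show "E \<in> sets P" using E sP by simp
    show "cis -` S \<inter> space P \<in> sets P"
      by (rule measurable_sets[OF measurable_borel_component[OF P cis] S])
  qed
  show ?thesis
    using recover[of M] recover[of N] recover[of L] null emeasure_cis_vimage_add[OF S] by simp
qed

end

lemma fourier_unique:
  assumes "finite_measure M" "finite_measure N" "sets M = sets borel_pi" "sets N = sets borel_pi"
    and "\<And>h. (\<integral>\<omega>. trig h \<omega> \<partial>M) = (\<integral>\<omega>. trig h \<omega> \<partial>N)"
    and "emeasure M {- pi} = 0" "emeasure N {- pi} = 0"
  shows "M = N"
proof (rule measure_eqI)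
  interpret additive_fourier M N "null_measure borel_pi"
    using assms by (intro additive_fourier.intro additive_fourier_axioms.intro) (auto intro!: finite_measureI)
  show "emeasure M E = emeasure N E" if "E \<in> sets M" for E
    using emeasure_add[of E] assms that by simp
qed (simp add: assms)

section \<open>Operator-valued spectral measures\<close>

lemma sums_nonneg_Reals:
  assumes "f sums s" "\<And>n. f n \<in> \<real>\<^sub>\<ge>\<^sub>0"
  shows "s \<in> (\<real>\<^sub>\<ge>\<^sub>0 :: complex set)"
proof (rule closed_sequentially[OF closed_nonneg_Reals_complex])
  show "(\<Sum>i<n. f i) \<in> \<real>\<^sub>\<ge>\<^sub>0" for n
    by (induction n) (auto intro: nonneg_Reals_add_I assms(2))
  show "(\<lambda>n. \<Sum>i<n. f i) \<longlonglongrightarrow> s" using assms(1) by (simp add: sums_def)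
qed

lemma integral_nonneg_Reals:
  fixes f :: "'b \<Rightarrow> complex"
  assumes "\<And>x. f x \<in> \<real>\<^sub>\<ge>\<^sub>0"
  shows "(\<integral>x. f x \<partial>M) \<in> \<real>\<^sub>\<ge>\<^sub>0"
proof -
  have f: "f x = of_real (Re (f x))" "0 \<le> Re (f x)" for x
    using assms[of x] by (auto simp: complex_nonneg_Reals_iff complex_eq_iff)
  have "(\<integral>x. f x \<partial>M) = (\<integral>x. of_real (Re (f x)) \<partial>M)"
    by (rule Bochner_Integration.integral_cong) (use f in auto)
  then show ?thesis using f(2) by (simp add: nonneg_Reals_of_real_iff)
qed

lemma fejer_sum_quadratic:
  assumes "\<And>h. \<Gamma> h \<in> bounded_ops"
  shows "fejer_sum (\<lambda>h. cinner (blinfun_apply (\<Gamma> h) x) x) N \<theta> =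
    (\<Sum>a=1..N. \<Sum>b=1..N. cinner (blinfun_apply (\<Gamma> (int a - int b)) (trig (int b) \<theta> *\<^sub>C x))
       (trig (int a) \<theta> *\<^sub>C x))"
  unfolding fejer_sum_def
proof (intro sum.cong refl)
  fix a b
  have "trig (int b - int a) \<theta> = trig (int b) \<theta> * cnj (trig (int a) \<theta>)"
    using trig_add[of "int b" "- int a" \<theta>] by (simp add: cnj_trig)
  then show "cinner (blinfun_apply (\<Gamma> (int a - int b)) x) x * trig (int b - int a) \<theta> =
      cinner (blinfun_apply (\<Gamma> (int a - int b)) (trig (int b) \<theta> *\<^sub>C x)) (trig (int a) \<theta> *\<^sub>C x)"
    by (simp add: bounded_opsD[OF assms] cinner_scaleC_left cinner_scaleC_right mult_ac)
qed

lemma nonneg_definite_fejer_sum: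
  assumes "nonneg_definite \<Gamma>" "\<And>h. \<Gamma> h \<in> bounded_ops"
  shows "fejer_sum (\<lambda>h. cinner (blinfun_apply (\<Gamma> h) x) x) N \<theta> \<in> \<real>\<^sub>\<ge>\<^sub>0"
  using assms(1)[unfolded nonneg_definite_def nonneg_definite_kernel_def, rule_format,
      where n=N and h=int and g="\<lambda>j. trig (int j) \<theta> *\<^sub>C x"]
  unfolding fejer_sum_quadratic[OF assms(2)] .

lemma fejer_sum_sums:
  assumes "\<And>h. (\<lambda>k. \<gamma> k h) sums \<delta> h"
  shows "(\<lambda>k. fejer_sum (\<gamma> k) N \<theta>) sums fejer_sum \<delta> N \<theta>"
  unfolding fejer_sum_def by (intro sums_sum sums_mult2 assms)

lemma fejer_sum_trace_nonneg:
  fixes \<Gamma> :: "int \<Rightarrow> 'a::complex_hilbert_space \<Rightarrow>\<^sub>L 'a"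
  assumes sep: "separable_space (euclidean :: 'a topology)"
    and nn: "nonneg_definite \<Gamma>" and \<Gamma>: "\<And>h. \<Gamma> h \<in> bounded_ops" and A: "A \<in> pos_trace_class"
  shows "fejer_sum (\<lambda>h. trace (\<Gamma> h o\<^sub>L A)) N \<theta> \<in> \<real>\<^sub>\<ge>\<^sub>0"
proof -
  obtain v :: "nat \<Rightarrow> 'a" where v:
    "\<And>T. T \<in> bounded_ops \<Longrightarrow> (\<lambda>k. cinner (blinfun_apply T (v k)) (v k)) sums trace (T o\<^sub>L A)"
    using trace_vector_expansion[OF sep A] by metis
  have "(\<lambda>k. fejer_sum (\<lambda>h. cinner (blinfun_apply (\<Gamma> h) (v k)) (v k)) N \<theta>)
      sums fejer_sum (\<lambda>h. trace (\<Gamma> h o\<^sub>L A)) N \<theta>"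
    by (intro fejer_sum_sums v \<Gamma>)
  then show ?thesis
    by (rule sums_nonneg_Reals) (rule nonneg_definite_fejer_sum[OF nn \<Gamma>])
qed

text \<open>The hypothesis concerns one vector at a time, the conclusion all \<open>g\<^sub>j\<close> together. With
  \<open>G \<theta> = (\<Sum>j. e\<^bsup>- i h\<^sub>j \<theta>\<^esup> g\<^sub>j)\<close> the Fejer sum at \<open>x = G \<theta>\<close> and \<open>\<theta>\<close> contains the terms
  \<open>e\<^bsup>i (h\<^sub>i - h\<^sub>j - k) \<theta>\<^esup> \<langle>\<Gamma> k g\<^sub>j, g\<^sub>i\<rangle>\<close>. Averaging over \<open>\<theta>\<close> keeps only \<open>k = h\<^sub>i - h\<^sub>j\<close>, with the
  weight \<open>fejer_count N (h\<^sub>i - h\<^sub>j)\<close>. After division by \<open>N\<close> the weights tend to \<open>1\<close>.\<close>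

lemma nonneg_definite_if_fejer_sum:
  fixes \<Gamma> :: "int \<Rightarrow> 'a::complex_hilbert_space \<Rightarrow>\<^sub>L 'a"
  assumes \<Gamma>: "\<And>h. \<Gamma> h \<in> bounded_ops"
    and pos: "\<And>x N \<theta>. fejer_sum (\<lambda>h. cinner (blinfun_apply (\<Gamma> h) x) x) N \<theta> \<in> \<real>\<^sub>\<ge>\<^sub>0"
  shows "nonneg_definite \<Gamma>"
  unfolding nonneg_definite_def nonneg_definite_kernel_def
proof (intro allI)
  fix n :: nat and h :: "nat \<Rightarrow> int" and g :: "nat \<Rightarrow> 'a"
  define s where "s i j = cinner (blinfun_apply (\<Gamma> (h i - h j)) (g j)) (g i)" for i j
  define G where "G \<theta> = (\<Sum>j=1..n. trig (- h j) \<theta> *\<^sub>C g j)" for \<theta>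
  have quad: "cinner (blinfun_apply (\<Gamma> k) (G \<theta>)) (G \<theta>) =
      (\<Sum>i=1..n. \<Sum>j=1..n. trig (h i - h j) \<theta> * cinner (blinfun_apply (\<Gamma> k) (g j)) (g i))" for k \<theta>
  proof -
    have "cinner (blinfun_apply (\<Gamma> k) (G \<theta>)) (G \<theta>) =
        (\<Sum>i=1..n. \<Sum>j=1..n. cinner (blinfun_apply (\<Gamma> k) (trig (- h j) \<theta> *\<^sub>C g j)) (trig (- h i) \<theta> *\<^sub>C g i))"
      unfolding G_def blinfun.sum_right cinner_sum_right unfolding cinner_sum_left ..
    also have "\<dots> = (\<Sum>i=1..n. \<Sum>j=1..n. trig (h i - h j) \<theta> * cinner (blinfun_apply (\<Gamma> k) (g j)) (g i))"
    proof (intro sum.cong refl)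
      fix i j
      have "trig (h i - h j) \<theta> = trig (- h j) \<theta> * cnj (trig (- h i) \<theta>)"
        using trig_add[of "h i" "- h j" \<theta>] by (simp add: cnj_trig)
      then show "cinner (blinfun_apply (\<Gamma> k) (trig (- h j) \<theta> *\<^sub>C g j)) (trig (- h i) \<theta> *\<^sub>C g i) =
          trig (h i - h j) \<theta> * cinner (blinfun_apply (\<Gamma> k) (g j)) (g i)"
        by (simp add: bounded_opsD[OF \<Gamma>] cinner_scaleC_left cinner_scaleC_right)
    qed
    finally show ?thesis .
  qed
  have avg: "(\<Sum>i=1..n. \<Sum>j=1..n. of_nat (fejer_count N (h i - h j)) * s i j) \<in> \<real>\<^sub>\<ge>\<^sub>0" for N
  proof -
    have "fejer_sum (\<lambda>k. cinner (blinfun_apply (\<Gamma> k) (G \<theta>)) (G \<theta>)) N \<theta> =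
        (\<Sum>i=1..n. \<Sum>j=1..n. trig (h i - h j) \<theta> *
          fejer_sum (\<lambda>k. cinner (blinfun_apply (\<Gamma> k) (g j)) (g i)) N \<theta>)" for \<theta>
    proof -
      \<comment> \<open>The Fejer sum is linear in the sequence of coefficients.\<close>
      have "fejer_sum (\<lambda>k. \<Sum>p\<in>P. c p * \<gamma> p k) N \<theta> = (\<Sum>p\<in>P. c p * fejer_sum (\<gamma> p) N \<theta>)"
        for P :: "(nat \<times> nat) set" and c \<gamma>
        by (induction P rule: infinite_finite_induct)
          (simp_all add: fejer_sum_def distrib_left distrib_right sum.distrib sum_distrib_left mult.assoc)
      from this[of "\<lambda>(i, j). trig (h i - h j) \<theta>" "\<lambda>(i, j) k. cinner (blinfun_apply (\<Gamma> k) (g j)) (g i)" "{1..n} \<times> {1..n}"]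
      show ?thesis unfolding quad by (simp add: sum.cartesian_product case_prod_unfold)
    qed
    then have "(\<Sum>i=1..n. \<Sum>j=1..n. trig (h i - h j) \<theta> *
          fejer_sum (\<lambda>k. cinner (blinfun_apply (\<Gamma> k) (g j)) (g i)) N \<theta>) \<in> \<real>\<^sub>\<ge>\<^sub>0" for \<theta>
      using pos by metis
    then have "(\<integral>\<theta>. (\<Sum>i=1..n. \<Sum>j=1..n. trig (h i - h j) \<theta> *
          fejer_sum (\<lambda>k. cinner (blinfun_apply (\<Gamma> k) (g j)) (g i)) N \<theta>) \<partial>circle_measure) \<in> \<real>\<^sub>\<ge>\<^sub>0"
      by (rule integral_nonneg_Reals)
    then show ?thesis
      by (simp add: Bochner_Integration.integral_sum integrable_trig_fejer_sum fejer_sum_coefficient s_def)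
  qed
  define w where "w N i j = real (fejer_count (Suc N) (h i - h j)) / real (Suc N)" for N i j
  have "(\<Sum>i=1..n. \<Sum>j=1..n. of_real (w N i j) * s i j) \<in> \<real>\<^sub>\<ge>\<^sub>0" for N
  proof -
    have "(\<Sum>i=1..n. \<Sum>j=1..n. of_real (w N i j) * s i j) = of_real (1 / real (Suc N)) *
        (\<Sum>i=1..n. \<Sum>j=1..n. of_nat (fejer_count (Suc N) (h i - h j)) * s i j)"
      by (simp add: sum_distrib_left w_def)
    also have "\<dots> \<in> \<real>\<^sub>\<ge>\<^sub>0"
      by (intro nonneg_Reals_mult_I avg) (simp only: nonneg_Reals_of_real_iff, simp)
    finally show ?thesis .
  qed
  moreover have "(\<lambda>N. \<Sum>i=1..n. \<Sum>j=1..n. of_real (w N i j) * s i j)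
      \<longlonglongrightarrow> (\<Sum>i=1..n. \<Sum>j=1..n. of_real 1 * s i j)"
    unfolding w_def by (intro tendsto_intros fejer_count_asymp)
  ultimately have "(\<Sum>i=1..n. \<Sum>j=1..n. of_real 1 * s i j) \<in> (\<real>\<^sub>\<ge>\<^sub>0 :: complex set)"
    by (rule closed_sequentially[OF closed_nonneg_Reals_complex])
  then show "(\<Sum>i=1..n. \<Sum>j=1..n. cinner (blinfun_apply (\<Gamma> (h i - h j)) (g j)) (g i)) \<in> \<real>\<^sub>\<ge>\<^sub>0"
    by (simp add: s_def)
qed

lemma space_borel_pi: "space borel_pi = {- pi..pi}"
  by (simp add: borel_pi_def space_restrict_space)

lemma in_sets_borel_pi: "{- pi..pi} \<in> sets borel_pi" "{- pi} \<in> sets borel_pi"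
  by (auto simp: borel_pi_def sets_restrict_space_iff)

lemma trace_zero [simp]: "trace 0 = 0"
  by (simp add: trace_def)

lemma op_as_map_zero: "A \<in> pos_trace_class \<Longrightarrow> op_as_map 0 A = 0"
  by (simp add: op_as_map_def)

text \<open>Countable additivity makes \<open>measure_of\<close> keep the prescribed values.\<close>

lemma scalar_measure_of_op_measure:
  assumes F: "finite_op_measure F" and A: "A \<in> pos_trace_class"
  shows "sets (scalar_measure F A) = sets borel_pi"
    and "E \<in> sets borel_pi \<Longrightarrow> emeasure (scalar_measure F A) E = F E A"
    and "finite_measure (scalar_measure F A)"
proof -
  have op: "op_measure F" and total: "F {- pi..pi} \<in> op_as_map ` pos_ops"
    using F by (auto simp: finite_op_measure_def)
  show sets: "sets (scalar_measure F A) = sets borel_pi"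
    by (simp add: scalar_measure_def)
  show em: "emeasure (scalar_measure F A) E = F E A" if E: "E \<in> sets borel_pi" for E
  proof (rule emeasure_measure_of[OF scalar_measure_def[of F A]])
    show "sets borel_pi \<subseteq> Pow (space borel_pi)" by (rule sets.space_closed)
    show "positive (sets (scalar_measure F A)) (\<lambda>E. F E A)"
      using op by (simp add: positive_def op_measure_def op_as_map_zero[OF A])
    show "countably_additive (sets (scalar_measure F A)) (\<lambda>E. F E A)"
      using op A unfolding countably_additive_def sets op_measure_def by metis
    show "E \<in> sets (scalar_measure F A)" using E sets by simp
  qed
  show "finite_measure (scalar_measure F A)"
  proof (rule finite_measureI)
    have "space (scalar_measure F A) = {- pi..pi}"
      using sets_eq_imp_space_eq[OF sets] by (simp add: space_borel_pi)
    moreover have "F {- pi..pi} A \<noteq> \<infinity>" using total A by (auto simp: op_as_map_def)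
    ultimately show "emeasure (scalar_measure F A) (space (scalar_measure F A)) \<noteq> \<infinity>"
      using em in_sets_borel_pi by simp
  qed
qed

lemma spectral_representation_scalar:
  assumes F: "spectral_representation \<Gamma> F" and A: "A \<in> pos_trace_class"
  shows "trace (\<Gamma> h o\<^sub>L A) = (\<integral>\<omega>. trig h \<omega> \<partial>scalar_measure F A)"
    and "finite_measure (scalar_measure F A)"
    and "sets (scalar_measure F A) = sets borel_pi"
    and "E \<in> sets borel_pi \<Longrightarrow> emeasure (scalar_measure F A) E = F E A"
    and "emeasure (scalar_measure F A) {- pi} = 0"
proof -
  have fin: "finite_op_measure F" and null: "F {- pi} = op_as_map 0"
    using F by (auto simp: spectral_representation_def)
  note S = scalar_measure_of_op_measure[OF fin A]
  show "trace (\<Gamma> h o\<^sub>L A) = (\<integral>\<omega>. trig h \<omega> \<partial>scalar_measure F A)"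
    using F A by (simp add: spectral_representation_def has_op_integral_def trig_def)
  show "finite_measure (scalar_measure F A)" "sets (scalar_measure F A) = sets borel_pi"
    "E \<in> sets borel_pi \<Longrightarrow> emeasure (scalar_measure F A) E = F E A" by (fact S)+
  show "emeasure (scalar_measure F A) {- pi} = 0"
    using S(2)[OF in_sets_borel_pi(2)] null by (simp add: op_as_map_zero[OF A])
qed

text \<open>After interchanging sums and integral, the integrand is \<open>\<bar>\<Sum>a\<le>N. e\<^bsup>i a (\<omega> - \<theta>)\<^esup>\<bar>\<^sup>2\<close>.\<close>

lemma fejer_sum_integral_nonneg:
  assumes fin: "finite_measure M" and sets: "sets M = sets borel_pi"
  shows "fejer_sum (\<lambda>h. \<integral>\<omega>. trig h \<omega> \<partial>M) N \<theta> \<in> \<real>\<^sub>\<ge>\<^sub>0"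
proof -
  have int: "integrable M (trig k)" for k
    by (rule integrable_trig[OF fin]) (use measurable_trig_borel_pi measurable_cong_sets[OF sets refl] in blast)
  have "fejer_sum (\<lambda>h. \<integral>\<omega>. trig h \<omega> \<partial>M) N \<theta> =
      (\<integral>\<omega>. (\<Sum>a=1..N. \<Sum>b=1..N. trig (int a - int b) \<omega> * trig (int b - int a) \<theta>) \<partial>M)"
    by (simp add: fejer_sum_def Bochner_Integration.integral_sum int)
  also have "\<dots> \<in> \<real>\<^sub>\<ge>\<^sub>0"
  proof (rule integral_nonneg_Reals)
    fix \<omega>
    define z where "z a = trig (int a) \<omega> * cnj (trig (int a) \<theta>)" for a
    have "trig (int a - int b) \<omega> * trig (int b - int a) \<theta> = z a * cnj (z b)" for a b
      using trig_add[of "int a" "- int b" \<omega>] trig_add[of "int b" "- int a" \<theta>]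
      by (simp add: z_def cnj_trig)
    then have "(\<Sum>a=1..N. \<Sum>b=1..N. trig (int a - int b) \<omega> * trig (int b - int a) \<theta>)
        = (\<Sum>a=1..N. z a) * cnj (\<Sum>a=1..N. z a)"
      by (simp add: sum_product)
    also have "\<dots> = of_real ((cmod (\<Sum>a=1..N. z a))\<^sup>2)" by (simp only: complex_norm_square)
    finally show "(\<Sum>a=1..N. \<Sum>b=1..N. trig (int a - int b) \<omega> * trig (int b - int a) \<theta>) \<in> \<real>\<^sub>\<ge>\<^sub>0"
      by (simp only: nonneg_Reals_of_real_iff zero_le_power2)
  qed
  finally show ?thesis .
qed

text \<open>The representation is evaluated at the rank one operators, for which the trace is
  \<open>\<langle>\<Gamma> h x, x\<rangle>\<close>.\<close>

lemma spectral_representation_nonneg_definite: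
  fixes \<Gamma> :: "int \<Rightarrow> 'a::complex_hilbert_space \<Rightarrow>\<^sub>L 'a"
  assumes sep: "separable_space (euclidean :: 'a topology)"
    and \<Gamma>: "\<And>h. \<Gamma> h \<in> bounded_ops" and F: "spectral_representation \<Gamma> F"
  shows "nonneg_definite \<Gamma>"
proof (rule nonneg_definite_if_fejer_sum[OF \<Gamma>])
  fix x :: 'a and N \<theta>
  note R = spectral_representation_scalar[OF F rank_one_pos_trace_class[OF sep, of x]]
  have "cinner (blinfun_apply (\<Gamma> h) x) x = (\<integral>\<omega>. trig h \<omega> \<partial>scalar_measure F (rank_one x))" for h
    using R(1)[of h] trace_rank_one[OF sep \<Gamma>] by simp
  then show "fejer_sum (\<lambda>h. cinner (blinfun_apply (\<Gamma> h) x) x) N \<theta> \<in> \<real>\<^sub>\<ge>\<^sub>0"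
    using fejer_sum_integral_nonneg[OF R(2,3)] by simp
qed

lemma spectral_representation_unique:
  fixes \<Gamma> :: "int \<Rightarrow> 'a::complex_hilbert_space \<Rightarrow>\<^sub>L 'a"
  assumes F: "spectral_representation \<Gamma> F" and G: "spectral_representation \<Gamma> G"
  shows "F = G"
proof -
  have ext: "F \<in> sets borel_pi \<rightarrow>\<^sub>E L_inf_plus" "G \<in> sets borel_pi \<rightarrow>\<^sub>E L_inf_plus"
    using F G by (auto simp: spectral_representation_def finite_op_measure_def op_measure_def)
  show ?thesis
  proof (rule PiE_ext[OF ext])
    fix E assume E: "E \<in> sets borel_pi"
    have "F E \<in> pos_trace_class \<rightarrow>\<^sub>E UNIV" "G E \<in> pos_trace_class \<rightarrow>\<^sub>E UNIV"
      using PiE_mem[OF ext(1) E] PiE_mem[OF ext(2) E] by (auto simp: L_inf_plus_def)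
    then show "F E = G E"
    proof (rule PiE_ext)
      fix A :: "'a \<Rightarrow>\<^sub>L 'a" assume A: "A \<in> pos_trace_class"
      note RF = spectral_representation_scalar[OF F A] and RG = spectral_representation_scalar[OF G A]
      have "scalar_measure F A = scalar_measure G A"
        using RF RG by (intro fourier_unique) auto
      then show "F E A = G E A" using RF(4)[OF E] RG(4)[OF E] by simp
    qed
  qed
qed

text \<open>Additivity of \<open>F E\<close> compares \<open>\<mu> (A + B)\<close> with \<open>\<mu> A\<close> and \<open>\<mu> B\<close> through their Fourier
  coefficients, and likewise \<open>\<mu> 0\<close> with the null measure.\<close>

lemma spectral_representation_exists:
  fixes \<Gamma> :: "int \<Rightarrow> 'a::complex_hilbert_space \<Rightarrow>\<^sub>L 'a"
  assumes sep: "separable_space (euclidean :: 'a topology)"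
    and \<Gamma>: "\<And>h. \<Gamma> h \<in> bounded_ops" and nn: "nonneg_definite \<Gamma>"
  shows "\<exists>F. spectral_representation \<Gamma> F"
proof -
  have "\<exists>\<mu>. finite_measure \<mu> \<and> sets \<mu> = sets borel_pi \<and> emeasure \<mu> {- pi} = 0 \<and>
      (\<forall>h. (\<integral>\<omega>. trig h \<omega> \<partial>\<mu>) = trace (\<Gamma> h o\<^sub>L A))" if "A \<in> pos_trace_class" for A
    using herglotz[OF fejer_sum_trace_nonneg[OF sep nn \<Gamma> that]] by metis
  then obtain \<mu> where \<mu>: "\<And>A. A \<in> pos_trace_class \<Longrightarrow> finite_measure (\<mu> A)"
    "\<And>A. A \<in> pos_trace_class \<Longrightarrow> sets (\<mu> A) = sets borel_pi"
    "\<And>A. A \<in> pos_trace_class \<Longrightarrow> emeasure (\<mu> A) {- pi} = 0"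
    "\<And>A h. A \<in> pos_trace_class \<Longrightarrow> (\<integral>\<omega>. trig h \<omega> \<partial>\<mu> A) = trace (\<Gamma> h o\<^sub>L A)"
    by metis
  have add: "emeasure (\<mu> (A + B)) E = emeasure (\<mu> A) E + emeasure (\<mu> B) E"
    if A: "A \<in> pos_trace_class" and B: "B \<in> pos_trace_class" and E: "E \<in> sets borel_pi" for A B E
  proof -
    note AB = pos_trace_class_add[OF A B]
    interpret additive_fourier "\<mu> (A + B)" "\<mu> A" "\<mu> B"
      using \<mu> A B AB trace_add_right[OF sep A B \<Gamma>]
      by (intro additive_fourier.intro additive_fourier_axioms.intro) auto
    show ?thesis using \<mu> A B AB E by (intro emeasure_add) auto
  qed
  have zero: "emeasure (\<mu> 0) E = 0" if "E \<in> sets borel_pi" for E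
  proof -
    have null_fin: "finite_measure (null_measure borel_pi)" by (rule finite_measureI) simp
    interpret additive_fourier "\<mu> 0" "null_measure borel_pi" "null_measure borel_pi"
      using \<mu> zero_pos_trace_class null_fin
      by (intro additive_fourier.intro additive_fourier_axioms.intro) auto
    show ?thesis using emeasure_add[OF _ _ _ that] \<mu>(3)[OF zero_pos_trace_class] by simp
  qed
  define F where "F = (\<lambda>E\<in>sets borel_pi. \<lambda>A\<in>pos_trace_class. emeasure (\<mu> A) E)"
  have F: "F E A = emeasure (\<mu> A) E" if "E \<in> sets borel_pi" "A \<in> pos_trace_class" for E A
    using that by (simp add: F_def)
  have F_ext: "F E \<in> extensional pos_trace_class" if "E \<in> sets borel_pi" for E
    using that by (simp add: F_def)
  have op_ext: "op_as_map B \<in> extensional pos_trace_class" for B :: "'a \<Rightarrow>\<^sub>L 'a"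
    by (simp add: op_as_map_def)
  have op: "op_measure F"
    unfolding op_measure_def
  proof (intro conjI allI impI ballI)
    show "F \<in> sets borel_pi \<rightarrow>\<^sub>E L_inf_plus"
    proof (rule PiE_I)
      fix E assume E: "E \<in> sets borel_pi"
      show "F E \<in> L_inf_plus"
        unfolding L_inf_plus_def
        using E F_ext[OF E] add zero
        by (simp add: PiE_def F pos_trace_class_add zero_pos_trace_class)
    qed (simp add: F_def)
    show "F {} = op_as_map 0"
      by (rule extensionalityI[OF F_ext op_ext]) (simp_all add: F op_as_map_zero)
    fix E :: "nat \<Rightarrow> real set" and A :: "'a \<Rightarrow>\<^sub>L 'a"
    assume E: "range E \<subseteq> sets borel_pi" "disjoint_family E" and A: "A \<in> pos_trace_class"
    have "(\<Union>i. E i) \<in> sets borel_pi" "\<And>i. E i \<in> sets borel_pi" using E by auto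
    then show "F (\<Union>i. E i) A = (\<Sum>i. F (E i) A)"
      using suminf_emeasure[of E "\<mu> A"] E \<mu>(2)[OF A] by (simp add: F A)
  qed
  have \<Gamma>0: "\<Gamma> 0 \<in> pos_ops"
  proof -
    have "cinner (blinfun_apply (\<Gamma> 0) x) x \<in> \<real>\<^sub>\<ge>\<^sub>0" for x
      using nonneg_definite_fejer_sum[OF nn \<Gamma>, of x 1 0] by (simp add: fejer_sum_def)
    then show ?thesis using \<Gamma> by (simp add: pos_ops_def)
  qed
  have "F {- pi..pi} = op_as_map (\<Gamma> 0)"
  proof (rule extensionalityI[OF F_ext[OF in_sets_borel_pi(1)] op_ext])
    fix A :: "'a \<Rightarrow>\<^sub>L 'a" assume A: "A \<in> pos_trace_class"
    interpret finite_measure "\<mu> A" by (rule \<mu>(1)[OF A])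
    have "space (\<mu> A) = {- pi..pi}"
      using sets_eq_imp_space_eq[OF \<mu>(2)[OF A]] by (simp add: space_borel_pi)
    moreover have "trace (\<Gamma> 0 o\<^sub>L A) = of_real (measure (\<mu> A) (space (\<mu> A)))"
      using \<mu>(4)[OF A, of 0] by (simp add: scaleR_conv_of_real)
    ultimately show "F {- pi..pi} A = op_as_map (\<Gamma> 0) A"
      using A in_sets_borel_pi by (simp add: F op_as_map_def emeasure_eq_measure)
  qed
  with op \<Gamma>0 have fin: "finite_op_measure F" by (auto simp: finite_op_measure_def)
  have "scalar_measure F A = \<mu> A" if A: "A \<in> pos_trace_class" for A
  proof (rule measure_eqI)
    note S = scalar_measure_of_op_measure[OF fin A]
    show "sets (scalar_measure F A) = sets (\<mu> A)" by (simp add: S \<mu> A)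
    show "emeasure (scalar_measure F A) E = emeasure (\<mu> A) E" if "E \<in> sets (scalar_measure F A)" for E
      using that by (simp add: S F A)
  qed
  then have "has_op_integral F (\<lambda>\<omega>. exp (\<i> * of_int h * of_real \<omega>)) (\<Gamma> h)" for h
    using \<mu>(4)[of _ h] \<Gamma> by (simp add: has_op_integral_def trig_def)
  moreover have "F {- pi} = op_as_map 0"
    by (rule extensionalityI[OF F_ext[OF in_sets_borel_pi(2)] op_ext])
      (simp_all add: F in_sets_borel_pi \<mu> op_as_map_zero)
  ultimately show ?thesis using fin unfolding spectral_representation_def by blast
qed

theorem theorem3p7:
  fixes \<Gamma> :: "int \<Rightarrow> 'a::complex_hilbert_space \<Rightarrow>\<^sub>L 'a"
  assumes "separable_space (euclidean :: 'a topology)"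
    and "\<And>h. \<Gamma> h \<in> bounded_ops"
  shows "(nonneg_definite \<Gamma> \<longleftrightarrow> (\<exists>F. spectral_representation \<Gamma> F)) \<and>
    (\<forall>F G. spectral_representation \<Gamma> F \<longrightarrow> spectral_representation \<Gamma> G \<longrightarrow> F = G)"
  using spectral_representation_exists[of \<Gamma>, OF assms]
    spectral_representation_nonneg_definite[of \<Gamma>, OF assms] spectral_representation_unique by blast

end
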